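(* Let $0\le k\le n$, let $\mathfrak{I}:\mathbb{X}_n\times\mathbb{X}_n\to\mathbb{R}$ be a complete $n$-symmetric $\mathrm{PDI}_k$ kernel that is zero on the extended diagonal $\Delta^n_{k-1}$, and let $\eta_j\in\mathcal{M}_k(\{1,2\}^j)$, $k\le j\le n$, be PI Reversible measures. Then for any fixed $x_{\vec 3}\in\mathbb{X}_n$ there exist real constants $b_j^{n,k}$, $k\le j\le n$, for which $$\mathfrak{I}(x_{\vec 1},x_{\vec 2})=\sum_{j=k}^n\ \sum_{F\subset\{1,\dots,n\},\,|F|=j}b_j^{n,k}\,\Big\|K^{\mathfrak{I}}_{\eta_j[x_{\vec 1_F},x_{\vec 2_F}]\times\delta_{x_{\vec 3_{F^c}}}}\Big\|^2_{\mathcal{H}_{\mathfrak{I}}}$$ for all $x_{\vec 1},x_{\vec 2}\in\mathbb{X}_n$ and for any $x_{\vec 0}\in\mathbb{X}_n$ that is used to define $K^{\mathfrak{I}}$.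
   Context: $X_1,\dots,X_n$ are nonempty sets, $\mathbb{X}_n=\prod_{i=1}^nX_i$, $\mathbb{X}_F=\prod_{i\in F}X_i$. For points $x_{\vec a}=(x_1^a,\dots,x_n^a)$ and a multi-index $\alpha$, $x_\alpha=(x_1^{\alpha_1},\dots,x_n^{\alpha_n})$; $x_{\vec a_F}$ is the projection of $x_{\vec a}$ to $\mathbb{X}_F$, and $x_{\vec a_F+\vec b_{F^c}}$ is the point with coordinates $x_i^a$ for $i\in F$, $x_i^b$ for $i\notin F$. For an $N$-fold product $\prod_{i=1}^{N}Z_i$ (in particular $\mathbb{X}_n$ and $\{1,2\}^j$), $\mathcal{M}_k$ denotes the set of finitely supported real signed measures $\mu$ on it with $\mu(\prod_iA_i)=0$ whenever $A_i\subset Z_i$ and $|\{i:A_i=Z_i\}|\ge N-k+1$. A kernel on $\mathbb{X}_n$ is $n$-symmetric if $\mathfrak{I}(x_{\vec 1},x_{\vec 2})=\mathfrak{I}(x_\alpha,x_{\vec 3-\alpha})$ for all $\alpha\in\{1,2\}^n$ and all points, where $\vec 3-\alpha=(3-\alpha_i)_i$; complete $n$-symmetric if moreover $\mathfrak{I}(x_{\vec 1_F+\vec 3_{F^c}},x_{\vec 2_F+\vec 3_{F^c}})=\mathfrak{I}(x_{\vec 1_F+\vec 4_{F^c}},x_{\vec 2_F+\vec 4_{F^c}})$ for all $F$ and all points; $\mathrm{PDI}_k$ if it is $n$-symmetric and $\iint(-1)^k\mathfrak{I}\,d\mu\,d\mu\ge0$ for all $\mu\in\mathcal{M}_k(\mathbb{X}_n)$.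 $\Delta^n_{k-1}$ is the set of pairs of points of $\mathbb{X}_n$ agreeing in at least $n-k+1$ coordinates. Put $\mu_k^n[x_{\vec 1},x_{\vec 0}]=\delta_{x_{\vec 1}}+\sum_{j=0}^{k-1}(-1)^{k-j}\binom{n-j-1}{n-k}\sum_{|F|=j}\delta_{x_{\vec 1_F+\vec 0_{F^c}}}$ and, for fixed $x_{\vec 0}$, $K^{\mathfrak{I}}(x,y)=\iint(-1)^k\mathfrak{I}(u,v)\,d\mu_k^n[x,x_{\vec 0}](u)\,d\mu_k^n[y,x_{\vec 0}](v)$, a positive definite kernel with reproducing kernel Hilbert space $\mathcal{H}_{\mathfrak{I}}$; for a finitely supported $\mu$, $K^{\mathfrak{I}}_\mu=\int K^{\mathfrak{I}}(\cdot,x)\,d\mu(x)\in\mathcal{H}_{\mathfrak{I}}$. A measure $\eta=\sum_{\alpha\in\{1,2\}^j}C_\alpha\delta_\alpha$ on $\{1,2\}^j$ is permutation invariant (PI) if $C_\alpha$ is unchanged under permutations of the entries of $\alpha$, and Reversible if $\sum_{\alpha\in\{1,2\}^j}C_\alpha C_{\vec 3-\alpha}\ne0$. For $F\subset\{1,\dots,n\}$ with $|F|=j$ (its elements in increasing order, identifying $\{1,2\}^j$ with $\{1,2\}^F$), $\eta[x_{\vec 1_F},x_{\vec 2_F}]=\sum_\alpha C_\alpha\delta_{(x_i^{\alpha_i})_{i\in F}}$, a measure on $\mathbb{X}_F$. $\{1,2\}^0$ is a one-point set. *)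

theory Defs
  imports "HOL-Analysis.Analysis" "HOL-Library.Poly_Mapping"
begin

text \<open>
  Points of a product over an index set \<open>J\<close> are elements of \<open>PiE J X\<close>; the coordinates are
  numbered from 1. A finitely supported signed measure is a value of type \<open>'p \<Rightarrow>\<^sub>0 real\<close>, so
  \<open>Poly_Mapping.single p c\<close> is the point mass \<open>c \<delta>\<^sub>p\<close>.
\<close>

type_synonym 'p fs_measure = "'p \<Rightarrow>\<^sub>0 real"

definition meas :: "'p fs_measure \<Rightarrow> 'p set \<Rightarrow> real" where
  "meas \<mu> A = (\<Sum>p\<in>Poly_Mapping.keys \<mu> \<inter> A. Poly_Mapping.lookup \<mu> p)"

definition fs_integral :: "'p fs_measure \<Rightarrow> ('p \<Rightarrow> real) \<Rightarrow> real" where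
  "fs_integral \<mu> f = (\<Sum>p\<in>Poly_Mapping.keys \<mu>. f p * Poly_Mapping.lookup \<mu> p)"

definition pushforward :: "('p \<Rightarrow> 'q) \<Rightarrow> 'p fs_measure \<Rightarrow> 'q fs_measure" where
  "pushforward f \<mu> =
    (\<Sum>p\<in>Poly_Mapping.keys \<mu>. Poly_Mapping.single (f p) (Poly_Mapping.lookup \<mu> p))"

definition splice :: "nat \<Rightarrow> nat set \<Rightarrow> (nat \<Rightarrow> 'a) \<Rightarrow> (nat \<Rightarrow> 'a) \<Rightarrow> nat \<Rightarrow> 'a" where
  "splice n F x y = merge F ({1..n} - F) (x, y)"

text \<open>Product of a measure on \<open>\<Prod>\<^sub>i\<^sub>\<in>\<^sub>F X\<^sub>i\<close> and a measure on the complementary product.\<close>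

definition product_measure ::
  "nat \<Rightarrow> nat set \<Rightarrow> (nat \<Rightarrow> 'a) fs_measure \<Rightarrow> (nat \<Rightarrow> 'a) fs_measure \<Rightarrow> (nat \<Rightarrow> 'a) fs_measure"
where
  "product_measure n F \<mu> \<nu> =
    (\<Sum>u\<in>Poly_Mapping.keys \<mu>. \<Sum>v\<in>Poly_Mapping.keys \<nu>.
       Poly_Mapping.single (splice n F u v) (Poly_Mapping.lookup \<mu> u * Poly_Mapping.lookup \<nu> v))"

text \<open>The condition \<open>N + 1 \<le> card \<dots> + k\<close> is \<open>card \<dots> \<ge> N - k + 1\<close> without truncated subtraction.\<close>

definition M_space :: "nat \<Rightarrow> nat \<Rightarrow> (nat \<Rightarrow> 'z set) \<Rightarrow> (nat \<Rightarrow> 'z) fs_measure set" where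
  "M_space k N Z =
    {\<mu>. Poly_Mapping.keys \<mu> \<subseteq> PiE {1..N} Z \<and>
        (\<forall>A. (\<forall>i\<in>{1..N}. A i \<subseteq> Z i) \<and> N + 1 \<le> card {i\<in>{1..N}. A i = Z i} + k \<longrightarrow>
             meas \<mu> (PiE {1..N} A) = 0)}"

text \<open>Multi-indices with entries in \<open>{1,2}\<close> and the selection \<open>x\<^sub>\<alpha>\<close> between two points.\<close>

abbreviation multi_indices :: "nat \<Rightarrow> (nat \<Rightarrow> nat) set" where
  "multi_indices j \<equiv> PiE {1..j} (\<lambda>_. {1, 2})"

definition flip :: "nat \<Rightarrow> (nat \<Rightarrow> nat) \<Rightarrow> nat \<Rightarrow> nat" where
  "flip j \<alpha> = (\<lambda>i\<in>{1..j}. 3 - \<alpha> i)"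

definition pick :: "nat set \<Rightarrow> (nat \<Rightarrow> nat) \<Rightarrow> (nat \<Rightarrow> 'a) \<Rightarrow> (nat \<Rightarrow> 'a) \<Rightarrow> nat \<Rightarrow> 'a" where
  "pick J \<alpha> x1 x2 = (\<lambda>i\<in>J. if \<alpha> i = 1 then x1 i else x2 i)"

definition n_symmetric ::
  "nat \<Rightarrow> (nat \<Rightarrow> 'a set) \<Rightarrow> ((nat \<Rightarrow> 'a) \<Rightarrow> (nat \<Rightarrow> 'a) \<Rightarrow> real) \<Rightarrow> bool" where
  "n_symmetric n X I \<longleftrightarrow>
    (\<forall>x1\<in>PiE {1..n} X. \<forall>x2\<in>PiE {1..n} X. \<forall>\<alpha>\<in>multi_indices n.
       I x1 x2 = I (pick {1..n} \<alpha> x1 x2) (pick {1..n} (flip n \<alpha>) x1 x2))"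

definition complete_n_symmetric ::
  "nat \<Rightarrow> (nat \<Rightarrow> 'a set) \<Rightarrow> ((nat \<Rightarrow> 'a) \<Rightarrow> (nat \<Rightarrow> 'a) \<Rightarrow> real) \<Rightarrow> bool" where
  "complete_n_symmetric n X I \<longleftrightarrow>
    n_symmetric n X I \<and>
    (\<forall>F\<subseteq>{1..n}. \<forall>x1\<in>PiE {1..n} X. \<forall>x2\<in>PiE {1..n} X. \<forall>x3\<in>PiE {1..n} X. \<forall>x4\<in>PiE {1..n} X.
       I (splice n F x1 x3) (splice n F x2 x3) = I (splice n F x1 x4) (splice n F x2 x4))"

definition PDI ::
  "nat \<Rightarrow> nat \<Rightarrow> (nat \<Rightarrow> 'a set) \<Rightarrow> ((nat \<Rightarrow> 'a) \<Rightarrow> (nat \<Rightarrow> 'a) \<Rightarrow> real) \<Rightarrow> bool" where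
  "PDI k n X I \<longleftrightarrow>
    n_symmetric n X I \<and>
    (\<forall>\<mu>\<in>M_space k n X. 0 \<le> fs_integral \<mu> (\<lambda>u. fs_integral \<mu> (\<lambda>v. (-1) ^ k * I u v)))"

text \<open>
  The extended diagonal \<open>\<Delta>\<close> with lower index \<open>k - 1\<close> (so that \<open>k = 0\<close>, where it is empty,
  is covered).
\<close>

definition extended_diagonal_pred ::
  "nat \<Rightarrow> nat \<Rightarrow> (nat \<Rightarrow> 'a set) \<Rightarrow> ((nat \<Rightarrow> 'a) \<times> (nat \<Rightarrow> 'a)) set" where
  "extended_diagonal_pred k n X =
    {(x, y) \<in> PiE {1..n} X \<times> PiE {1..n} X. n + 1 \<le> card {i\<in>{1..n}. x i = y i} + k}"

definition mu_meas ::
  "nat \<Rightarrow> nat \<Rightarrow> (nat \<Rightarrow> 'a) \<Rightarrow> (nat \<Rightarrow> 'a) \<Rightarrow> (nat \<Rightarrow> 'a) fs_measure" where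
  "mu_meas k n x1 x0 =
    Poly_Mapping.single x1 1 +
    (\<Sum>j<k. \<Sum>F | F \<subseteq> {1..n} \<and> card F = j.
       Poly_Mapping.single (splice n F x1 x0) ((-1) ^ (k - j) * real ((n - j - 1) choose (n - k))))"

definition kernel_of ::
  "nat \<Rightarrow> nat \<Rightarrow> ((nat \<Rightarrow> 'a) \<Rightarrow> (nat \<Rightarrow> 'a) \<Rightarrow> real) \<Rightarrow> (nat \<Rightarrow> 'a) \<Rightarrow>
   (nat \<Rightarrow> 'a) \<Rightarrow> (nat \<Rightarrow> 'a) \<Rightarrow> real" where
  "kernel_of k n I x0 x y =
    fs_integral (mu_meas k n x x0) (\<lambda>u. fs_integral (mu_meas k n y x0) (\<lambda>v. (-1) ^ k * I u v))"

text \<open>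
  Hilbert spaces of real functions on a set \<open>S\<close>. Functions on \<open>S\<close> are represented by functions on
  the whole type that vanish outside \<open>S\<close>, so that the pointwise operations need no restriction.
\<close>

locale function_hilbert_space =
  fixes S :: "'p set" and H :: "('p \<Rightarrow> real) set" and ip :: "('p \<Rightarrow> real) \<Rightarrow> ('p \<Rightarrow> real) \<Rightarrow> real"
  assumes zero_outside: "\<And>f x. f \<in> H \<Longrightarrow> x \<notin> S \<Longrightarrow> f x = 0"
    and zero_mem: "(\<lambda>_. 0) \<in> H"
    and add_mem: "\<And>f g. f \<in> H \<Longrightarrow> g \<in> H \<Longrightarrow> (\<lambda>x. f x + g x) \<in> H"
    and scale_mem: "\<And>c f. f \<in> H \<Longrightarrow> (\<lambda>x. c * f x) \<in> H"
    and ip_commute: "\<And>f g. f \<in> H \<Longrightarrow> g \<in> H \<Longrightarrow> ip f g = ip g f"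
    and ip_add_left: "\<And>f g h. f \<in> H \<Longrightarrow> g \<in> H \<Longrightarrow> h \<in> H \<Longrightarrow>
          ip (\<lambda>x. f x + g x) h = ip f h + ip g h"
    and ip_scale_left: "\<And>c f g. f \<in> H \<Longrightarrow> g \<in> H \<Longrightarrow> ip (\<lambda>x. c * f x) g = c * ip f g"
    and ip_nonneg: "\<And>f. f \<in> H \<Longrightarrow> 0 \<le> ip f f"
    and ip_definite: "\<And>f. f \<in> H \<Longrightarrow> ip f f = 0 \<Longrightarrow> f = (\<lambda>_. 0)"
    and complete: "Metric_space.mcomplete H
          (\<lambda>f g. sqrt (ip (\<lambda>x. f x - g x) (\<lambda>x. f x - g x)))"

definition kernel_section :: "'p set \<Rightarrow> ('p \<Rightarrow> 'p \<Rightarrow> real) \<Rightarrow> 'p \<Rightarrow> 'p \<Rightarrow> real" where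
  "kernel_section S K x = (\<lambda>y. if y \<in> S then K y x else 0)"

locale reproducing_kernel_hilbert_space = function_hilbert_space S H ip
  for S :: "'p set" and H :: "('p \<Rightarrow> real) set" and ip :: "('p \<Rightarrow> real) \<Rightarrow> ('p \<Rightarrow> real) \<Rightarrow> real" +
  fixes K :: "'p \<Rightarrow> 'p \<Rightarrow> real"
  assumes section_mem: "\<And>x. x \<in> S \<Longrightarrow> kernel_section S K x \<in> H"
    and reproducing: "\<And>f x. f \<in> H \<Longrightarrow> x \<in> S \<Longrightarrow> ip f (kernel_section S K x) = f x"

text \<open>
  By the Moore--Aronszajn theorem a positive definite kernel on \<open>S\<close> has a reproducing kernel
  Hilbert space, which is unique up to the irrelevant values of \<open>ip\<close> outside \<open>H\<close>; hence the
  choice below does not affect the norm of a member of the space.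
\<close>

definition the_rkhs ::
  "'p set \<Rightarrow> ('p \<Rightarrow> 'p \<Rightarrow> real) \<Rightarrow> ('p \<Rightarrow> real) set \<times> (('p \<Rightarrow> real) \<Rightarrow> ('p \<Rightarrow> real) \<Rightarrow> real)"
where
  "the_rkhs S K = (SOME R. reproducing_kernel_hilbert_space S (fst R) (snd R) K)"

definition rkhs_norm :: "'p set \<Rightarrow> ('p \<Rightarrow> 'p \<Rightarrow> real) \<Rightarrow> ('p \<Rightarrow> real) \<Rightarrow> real" where
  "rkhs_norm S K f = sqrt (snd (the_rkhs S K) f f)"

definition kernel_embedding ::
  "'p set \<Rightarrow> ('p \<Rightarrow> 'p \<Rightarrow> real) \<Rightarrow> 'p fs_measure \<Rightarrow> 'p \<Rightarrow> real" where
  "kernel_embedding S K \<mu> = (\<lambda>y. if y \<in> S then fs_integral \<mu> (\<lambda>x. K y x) else 0)"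

definition permutation_invariant :: "nat \<Rightarrow> (nat \<Rightarrow> nat) fs_measure \<Rightarrow> bool" where
  "permutation_invariant j \<eta> \<longleftrightarrow>
    (\<forall>\<pi>. \<pi> permutes {1..j} \<longrightarrow>
       (\<forall>\<alpha>\<in>multi_indices j. Poly_Mapping.lookup \<eta> (\<alpha> \<circ> \<pi>) = Poly_Mapping.lookup \<eta> \<alpha>))"

definition reversible :: "nat \<Rightarrow> (nat \<Rightarrow> nat) fs_measure \<Rightarrow> bool" where
  "reversible j \<eta> \<longleftrightarrow>
    (\<Sum>\<alpha>\<in>multi_indices j. Poly_Mapping.lookup \<eta> \<alpha> * Poly_Mapping.lookup \<eta> (flip j \<alpha>)) \<noteq> 0"

text \<open>
  For \<open>i \<in> F\<close>, \<open>card {l\<in>F. l \<le> i}\<close> is the position of \<open>i\<close> in the increasing enumeration of \<open>F\<close>;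
  this identifies multi-indices on \<open>{1..card F}\<close> with multi-indices on \<open>F\<close>.
\<close>

definition spread :: "nat set \<Rightarrow> (nat \<Rightarrow> nat) \<Rightarrow> nat \<Rightarrow> nat" where
  "spread F \<alpha> = (\<lambda>i\<in>F. \<alpha> (card {l\<in>F. l \<le> i}))"

definition eta_at ::
  "nat set \<Rightarrow> (nat \<Rightarrow> nat) fs_measure \<Rightarrow> (nat \<Rightarrow> 'a) \<Rightarrow> (nat \<Rightarrow> 'a) \<Rightarrow> (nat \<Rightarrow> 'a) fs_measure"
where
  "eta_at F \<eta> x1 x2 = pushforward (\<lambda>\<alpha>. pick F (spread F \<alpha>) x1 x2) \<eta>"

end

theory Submission
  imports Defs
begin

text \<open>
  For \<open>\<mu>\<close> in \<open>M_space k n X\<close> the marginals of \<open>\<mu>\<close> on fewer than \<open>k\<close> coordinates vanish, so averaging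
  \<open>mu_meas\<close> over \<open>\<mu>\<close> gives back \<open>\<mu>\<close> and the squared norm of the embedding of \<open>\<mu>\<close> is
  \<open>(-1)^k \<integral>\<integral> I d\<mu> d\<mu>\<close>, whatever the base point \<open>x0\<close>. For \<open>\<mu>\<close> built from \<open>\<eta>\<^sub>j\<close> on \<open>F\<close>, completeness and
  symmetry turn each summand \<open>I(x\<^sub>\<alpha>, x\<^sub>\<beta>)\<close> into a number \<open>J(D)\<close> that depends only on the set \<open>D\<close> where
  \<open>\<alpha>\<close> and \<open>\<beta>\<close> differ, and by permutation invariance its total weight depends only on \<open>card D\<close>. As
  \<open>J(D) = 0\<close> for \<open>card D < k\<close>, summing over all \<open>F\<close> of size \<open>j\<close> expresses the norms as a triangular
  system in \<open>S\<^sub>m = \<Sum>\<^bsub>card D = m\<^esub> J(D)\<close>, \<open>k \<le> m \<le> j\<close>. Reversibility says exactly that its diagonal does not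
  vanish, so it can be solved for \<open>S\<^sub>n = I(x1, x2)\<close>.
\<close>

section \<open>Integration against finitely supported measures\<close>

definition fs_scale :: "real \<Rightarrow> 'p fs_measure \<Rightarrow> 'p fs_measure" where
  "fs_scale c \<mu> = Poly_Mapping.map ((*) c) \<mu>"

lemma lookup_fs_scale [simp]: "Poly_Mapping.lookup (fs_scale c \<mu>) p = c * Poly_Mapping.lookup \<mu> p"
  by (auto simp: fs_scale_def Poly_Mapping.map.rep_eq when_def)

lemma keys_fs_scale: "Poly_Mapping.keys (fs_scale c \<mu>) \<subseteq> Poly_Mapping.keys \<mu>"
  by (auto simp: in_keys_iff)

lemma fs_integral_superset:
  assumes "finite A" "Poly_Mapping.keys \<mu> \<subseteq> A"
  shows "fs_integral \<mu> f = (\<Sum>p\<in>A. f p * Poly_Mapping.lookup \<mu> p)"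
  unfolding fs_integral_def using assms
  by (intro sum.mono_neutral_left) (auto simp: in_keys_iff)

lemma fs_integral_cong:
  "(\<And>p. p \<in> Poly_Mapping.keys \<mu> \<Longrightarrow> f p = g p) \<Longrightarrow> fs_integral \<mu> f = fs_integral \<mu> g"
  by (simp add: fs_integral_def)

lemma fs_integral_add_measure: "fs_integral (\<mu> + \<nu>) f = fs_integral \<mu> f + fs_integral \<nu> f"
proof -
  let ?A = "Poly_Mapping.keys \<mu> \<union> Poly_Mapping.keys \<nu>"
  have "fs_integral (\<mu> + \<nu>) f = (\<Sum>p\<in>?A. f p * Poly_Mapping.lookup (\<mu> + \<nu>) p)"
    using keys_add[of \<mu> \<nu>] by (intro fs_integral_superset) auto
  also have "\<dots> = fs_integral \<mu> f + fs_integral \<nu> f"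
    by (subst (1 2) fs_integral_superset[of ?A])
       (auto simp: lookup_add algebra_simps sum.distrib)
  finally show ?thesis .
qed

lemma fs_integral_scale_measure: "fs_integral (fs_scale c \<mu>) f = c * fs_integral \<mu> f"
  by (subst fs_integral_superset[of "Poly_Mapping.keys \<mu>"])
     (use keys_fs_scale[of c \<mu>] in \<open>auto simp: fs_integral_def sum_distrib_left algebra_simps\<close>)

lemma fs_integral_zero_measure [simp]: "fs_integral 0 f = 0"
  by (simp add: fs_integral_def)

lemma fs_integral_sum_measure: "fs_integral (\<Sum>a\<in>A. \<mu> a) f = (\<Sum>a\<in>A. fs_integral (\<mu> a) f)"
  by (induction A rule: infinite_finite_induct) (auto simp: fs_integral_add_measure)

lemma fs_integral_diff_measure: "fs_integral (\<mu> - \<nu>) f = fs_integral \<mu> f - fs_integral \<nu> f"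
  using fs_integral_add_measure[of "\<mu> - \<nu>" \<nu> f] by simp

lemma fs_integral_single [simp]: "fs_integral (Poly_Mapping.single p c) f = f p * c"
  by (subst fs_integral_superset[of "{p}"]) auto

lemma fs_integral_add: "fs_integral \<mu> (\<lambda>p. f p + g p) = fs_integral \<mu> f + fs_integral \<mu> g"
  by (simp add: fs_integral_def sum.distrib algebra_simps)

lemma fs_integral_diff: "fs_integral \<mu> (\<lambda>p. f p - g p) = fs_integral \<mu> f - fs_integral \<mu> g"
  by (simp add: fs_integral_def sum_subtractf algebra_simps)

lemma fs_integral_scale: "fs_integral \<mu> (\<lambda>p. c * f p) = c * fs_integral \<mu> f"
  by (simp add: fs_integral_def sum_distrib_left algebra_simps)

lemma fs_integral_zero [simp]: "fs_integral \<mu> (\<lambda>p. 0) = 0"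
  by (simp add: fs_integral_def)

lemma fs_integral_sum: "fs_integral \<mu> (\<lambda>p. \<Sum>a\<in>A. f a p) = (\<Sum>a\<in>A. fs_integral \<mu> (f a))"
  by (induction A rule: infinite_finite_induct) (auto simp: fs_integral_add)

lemma fs_integral_swap:
  "fs_integral \<mu> (\<lambda>x. fs_integral \<nu> (\<lambda>y. f x y)) = fs_integral \<nu> (\<lambda>y. fs_integral \<mu> (\<lambda>x. f x y))"
  unfolding fs_integral_def sum_distrib_right
  by (subst sum.swap) (simp add: mult_ac)

lemma fs_integral_pushforward: "fs_integral (pushforward h \<mu>) f = fs_integral \<mu> (\<lambda>p. f (h p))"
  by (simp add: pushforward_def fs_integral_sum_measure) (simp add: fs_integral_def)

lemma meas_eq_fs_integral: "meas \<mu> A = fs_integral \<mu> (indicator A)"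
  unfolding meas_def fs_integral_def indicator_def
  by (intro sum.mono_neutral_cong_left) auto


section \<open>Existence of reproducing kernel Hilbert spaces\<close>

text \<open>The discriminant argument of Cauchy-Schwarz: for \<open>q > 0\<close> the left side
  peaks at \<open>t = a / q\<close> with value \<open>a\<^sup>2 / q\<close>, and for
  \<open>q = 0\<close> it is linear in \<open>t\<close>, hence bounded only if
  \<open>a = 0\<close>.\<close>

lemma quadratic_bound:
  fixes a q e :: real
  assumes le: "\<And>t. 2 * t * a - t\<^sup>2 * q \<le> e\<^sup>2" and "0 \<le> q" "0 \<le> e"
  shows "\<bar>a\<bar> \<le> e * sqrt q"
proof (cases "q = 0")
  case True
  have "a = 0"
  proof (rule ccontr)
    assume "a \<noteq> 0"
    then have "2 * (e\<^sup>2 + 1) \<le> e\<^sup>2"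
      using le[of "(e\<^sup>2 + 1) / a"] True by simp
    moreover have "0 \<le> e\<^sup>2" by simp
    ultimately show False by (smt (verit))
  qed
  then show ?thesis using True by simp
next
  case False
  then have "q > 0" using assms by simp
  then have "a\<^sup>2 \<le> e\<^sup>2 * q"
    using le[of "a / q"] by (simp add: field_simps power2_eq_square)
  then have "sqrt (a\<^sup>2) \<le> sqrt (e\<^sup>2 * q)" by (rule real_sqrt_le_mono)
  then show ?thesis using assms by (simp add: real_sqrt_mult)
qed

text \<open>Kernels here live on the whole type; a kernel on a subset is extended by zero below, and
  that makes the functions of the space vanish outside the subset.\<close>

locale psd_kernel =
  fixes K :: "'p \<Rightarrow> 'p \<Rightarrow> real"
  assumes K_sym: "K x y = K y x"
    and K_psd: "finite A \<Longrightarrow> 0 \<le> (\<Sum>x\<in>A. \<Sum>y\<in>A. c x * c y * K x y)"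
begin

definition form :: "'p fs_measure \<Rightarrow> 'p fs_measure \<Rightarrow> real" where
  "form c d = fs_integral c (\<lambda>x. fs_integral d (K x))"

definition embed :: "'p fs_measure \<Rightarrow> 'p \<Rightarrow> real" where
  "embed c x = fs_integral c (\<lambda>y. K y x)"

definition fnorm :: "'p fs_measure \<Rightarrow> real" where
  "fnorm c = sqrt (form c c)"

text \<open>Stands for the completion of the span of the kernel sections, realised among functions
  without any quotient: \<open>f\<close> belongs when its integral is a bounded functional for the
  seminorm \<open>fnorm\<close>. The least nonnegative bound will be the norm of
  \<open>f\<close>.\<close>

definition rkhs :: "('p \<Rightarrow> real) set" where
  "rkhs = {f. \<exists>C. \<forall>c. \<bar>fs_integral c f\<bar> \<le> C * fnorm c}"

text \<open>Expresses that \<open>embed c\<close> is within \<open>e\<close> of \<open>f\<close> in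
  the dual norm, before that norm is available.\<close>

definition approximates :: "'p fs_measure \<Rightarrow> real \<Rightarrow> ('p \<Rightarrow> real) \<Rightarrow> bool" where
  "approximates c e f \<longleftrightarrow> (\<forall>d. \<bar>fs_integral d f - form c d\<bar> \<le> e * fnorm d)"

definition approximant :: "('p \<Rightarrow> real) \<Rightarrow> nat \<Rightarrow> 'p fs_measure" where
  "approximant f n = (SOME c. approximates c (inverse (Suc n)) f)"

text \<open>
  The value \<open>0\<close> outside \<open>rkhs\<close> makes the induced distance symmetric on the whole type, as
  \<open>Metric_space\<close> demands.
\<close>

definition inner_prod :: "('p \<Rightarrow> real) \<Rightarrow> ('p \<Rightarrow> real) \<Rightarrow> real" where
  "inner_prod f g =
    (if f \<in> rkhs \<and> g \<in> rkhs then lim (\<lambda>n. fs_integral (approximant f n) g) else 0)"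

section \<open>The semi-inner product on finitely supported measures\<close>

lemma form_embed: "form c d = fs_integral d (embed c)"
  unfolding form_def embed_def by (rule fs_integral_swap)

lemma form_commute: "form c d = form d c"
  unfolding form_def by (subst fs_integral_swap) (simp add: K_sym)

lemma form_linear:
  "form (a + b) d = form a d + form b d" "form d (a + b) = form d a + form d b"
  "form (a - b) d = form a d - form b d" "form d (a - b) = form d a - form d b"
  "form (fs_scale t a) d = t * form a d" "form d (fs_scale t a) = t * form d a"
  by (simp_all add: form_def fs_integral_add_measure fs_integral_diff_measure
      fs_integral_scale_measure fs_integral_add fs_integral_diff fs_integral_scale)

lemma form_nonneg: "0 \<le> form c c"
proof -
  have "form c c = (\<Sum>x\<in>Poly_Mapping.keys c. \<Sum>y\<in>Poly_Mapping.keys c.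
          Poly_Mapping.lookup c x * Poly_Mapping.lookup c y * K x y)"
    by (simp add: form_def fs_integral_def sum_distrib_left sum_distrib_right mult_ac)
  then show ?thesis using K_psd by simp
qed

lemma fnorm_nonneg: "0 \<le> fnorm c"
  by (simp add: fnorm_def form_nonneg)

lemma fnorm_power2: "(fnorm c)\<^sup>2 = form c c"
  by (simp add: fnorm_def form_nonneg)

lemma form_Cauchy_Schwarz: "\<bar>form c d\<bar> \<le> fnorm c * fnorm d"
proof -
  have "2 * t * form c d - t\<^sup>2 * form d d \<le> (fnorm c)\<^sup>2" for t
    using form_nonneg[of "c - fs_scale t d"]
    by (simp add: form_linear form_commute[of d c] fnorm_power2 power2_eq_square[of t] algebra_simps)
  then show ?thesis
    using quadratic_bound[of "form c d" "form d d" "fnorm c"] form_nonneg fnorm_nonneg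
    by (simp add: fnorm_def)
qed

lemma rkhs_bound:
  assumes "f \<in> rkhs"
  obtains C where "C \<ge> 0" "\<And>c. \<bar>fs_integral c f\<bar> \<le> C * fnorm c"
proof -
  obtain C where C: "\<And>c. \<bar>fs_integral c f\<bar> \<le> C * fnorm c"
    using assms by (auto simp: rkhs_def)
  have "C * fnorm c \<le> \<bar>C\<bar> * fnorm c" for c
    using fnorm_nonneg by (intro mult_right_mono) auto
  then have "\<bar>fs_integral c f\<bar> \<le> \<bar>C\<bar> * fnorm c" for c
    using C[of c] order_trans by blast
  then show ?thesis using that[of "\<bar>C\<bar>"] by simp
qed

text \<open>
  The squared norm of \<open>f\<close> is the supremum of \<open>2 \<integral>f dc - form c c\<close>, and a near maximizer \<open>c\<close>
  approximates \<open>f\<close>.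
\<close>

lemma approximates_exists:
  assumes "f \<in> rkhs" "e > 0"
  shows "\<exists>c. approximates c e f"
proof -
  obtain C where C: "C \<ge> 0" "\<And>c. \<bar>fs_integral c f\<bar> \<le> C * fnorm c"
    using rkhs_bound[OF assms(1)] by blast
  define V where "V = (\<lambda>c. 2 * fs_integral c f - form c c)"
  have "V c \<le> C\<^sup>2" for c
  proof -
    have "V c \<le> 2 * (C * fnorm c) - (fnorm c)\<^sup>2"
      using C(2)[of c] by (simp add: V_def fnorm_power2)
    also have "\<dots> \<le> C\<^sup>2"
      using zero_le_power2[of "C - fnorm c"] by (simp add: power2_diff)
    finally show ?thesis .
  qed
  then have bdd: "bdd_above (range V)" by (intro bdd_aboveI) auto
  have "\<exists>c. Sup (range V) - e\<^sup>2 < V c"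
    using less_cSupD[of "range V" "Sup (range V) - e\<^sup>2"] assms(2) by auto
  then obtain c where c: "Sup (range V) - e\<^sup>2 < V c" by blast
  have "\<bar>fs_integral d f - form c d\<bar> \<le> e * fnorm d" for d
  proof -
    \<comment> \<open>As \<open>V c\<close> is within \<open>e\<^sup>2\<close> of the supremum,
      moving \<open>c\<close> by any multiple \<open>t\<close> of \<open>d\<close> gains at most
      \<open>e\<^sup>2\<close>; the gain is this quadratic in \<open>t\<close>.\<close>
    have "2 * t * (fs_integral d f - form c d) - t\<^sup>2 * form d d \<le> e\<^sup>2" for t
    proof -
      have "V (c + fs_scale t d) \<le> Sup (range V)"
        using bdd by (intro cSup_upper) auto
      then have "V (c + fs_scale t d) \<le> V c + e\<^sup>2" using c by simp
      then show ?thesis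
        by (simp add: V_def form_linear form_commute[of d c] fs_integral_add_measure
            fs_integral_scale_measure power2_eq_square algebra_simps)
    qed
    then show ?thesis
      using quadratic_bound[of _ "form d d" e] form_nonneg assms(2) by (simp add: fnorm_def)
  qed
  then show ?thesis by (auto simp: approximates_def)
qed

lemma approximant: "f \<in> rkhs \<Longrightarrow> approximates (approximant f n) (inverse (Suc n)) f"
  unfolding approximant_def by (rule someI_ex, rule approximates_exists) simp_all

text \<open>Test both approximations on \<open>c - c'\<close> itself and cancel one factor
  \<open>fnorm (c - c')\<close>. This makes the approximants of one function Cauchy in the
  seminorm.\<close>

lemma approximates_fnorm_diff:
  assumes "approximates c e f" "approximates c' e' f" "0 \<le> e" "0 \<le> e'"
  shows "fnorm (c - c') \<le> e + e'"
proof -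
  let ?d = "c - c'"
  have "form ?d ?d = form c ?d - form c' ?d" by (simp add: form_linear)
  then have "fnorm ?d * fnorm ?d \<le> (e + e') * fnorm ?d"
    using assms(1,2)[unfolded approximates_def, THEN spec[of _ ?d]]
    by (simp add: fnorm_power2 distrib_right flip: power2_eq_square)
  then show ?thesis
    using fnorm_nonneg[of ?d] assms(3,4)
    by (cases "fnorm ?d = 0") (auto simp: mult_le_cancel_right)
qed

lemma approximates_fnorm_le:
  assumes "approximates c e f" "\<And>c. \<bar>fs_integral c f\<bar> \<le> C * fnorm c" "0 \<le> C" "0 \<le> e"
  shows "fnorm c \<le> C + e"
proof -
  have "fnorm c * fnorm c \<le> (C + e) * fnorm c"
    using assms(1)[unfolded approximates_def, THEN spec[of _ c]] assms(2)[of c]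
    by (simp add: fnorm_power2 distrib_right flip: power2_eq_square)
  then show ?thesis
    using fnorm_nonneg[of c] assms(3,4)
    by (cases "fnorm c = 0") (auto simp: mult_le_cancel_right)
qed

section \<open>Linear structure and inner product of the function space\<close>

lemma rkhs_zero: "(\<lambda>_. 0) \<in> rkhs"
  using fnorm_nonneg by (auto simp: rkhs_def intro!: exI[of _ 0])

lemma rkhs_add:
  assumes "f \<in> rkhs" "g \<in> rkhs"
  shows "(\<lambda>x. f x + g x) \<in> rkhs"
proof -
  obtain C D where "\<And>c. \<bar>fs_integral c f\<bar> \<le> C * fnorm c" "\<And>c. \<bar>fs_integral c g\<bar> \<le> D * fnorm c"
    using assms by (auto simp: rkhs_def)
  then have "\<bar>fs_integral c (\<lambda>x. f x + g x)\<bar> \<le> (C + D) * fnorm c" for c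
    unfolding fs_integral_add distrib_right by (smt (verit))
  then show ?thesis by (auto simp: rkhs_def)
qed

lemma rkhs_scale:
  assumes "f \<in> rkhs"
  shows "(\<lambda>x. t * f x) \<in> rkhs"
proof -
  obtain C where "\<And>c. \<bar>fs_integral c f\<bar> \<le> C * fnorm c"
    using assms by (auto simp: rkhs_def)
  then have "\<bar>fs_integral c (\<lambda>x. t * f x)\<bar> \<le> (\<bar>t\<bar> * C) * fnorm c" for c
    by (simp add: fs_integral_scale abs_mult mult_left_mono mult.assoc)
  then show ?thesis by (auto simp: rkhs_def)
qed

lemma rkhs_diff:
  assumes "f \<in> rkhs" "g \<in> rkhs"
  shows "(\<lambda>x. f x - g x) \<in> rkhs"
  using rkhs_add[OF assms(1) rkhs_scale[OF assms(2), of "-1"]] by simp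

lemma embed_mem: "embed c \<in> rkhs"
  using form_Cauchy_Schwarz by (auto simp: rkhs_def form_embed[symmetric])

text \<open>The approximants of \<open>f\<close> are Cauchy in \<open>fnorm\<close> and integration
  of \<open>g\<close> is bounded for it, so the limit in \<open>inner_prod\<close> exists.\<close>

lemma inner_prod_tendsto:
  assumes "f \<in> rkhs" "g \<in> rkhs"
  shows "(\<lambda>n. fs_integral (approximant f n) g) \<longlonglongrightarrow> inner_prod f g"
proof -
  obtain C where C: "C \<ge> 0" "\<And>c. \<bar>fs_integral c g\<bar> \<le> C * fnorm c"
    using rkhs_bound[OF assms(2)] by blast
  let ?e = "\<lambda>n. inverse (real (Suc n))"
  have le: "\<bar>fs_integral (approximant f m) g - fs_integral (approximant f n) g\<bar> \<le> C * (?e m + ?e n)"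
    for m n
  proof -
    have "fnorm (approximant f m - approximant f n) \<le> ?e m + ?e n"
      by (rule approximates_fnorm_diff) (use approximant[OF assms(1)] in auto)
    then have "C * fnorm (approximant f m - approximant f n) \<le> C * (?e m + ?e n)"
      using C(1) by (rule mult_left_mono)
    then show ?thesis
      using C(2)[of "approximant f m - approximant f n"] by (simp add: fs_integral_diff_measure)
  qed
  have "Cauchy (\<lambda>n. fs_integral (approximant f n) g)"
  proof (rule CauchyI)
    fix \<epsilon> :: real assume \<epsilon>: "\<epsilon> > 0"
    have "(\<lambda>n. 2 * C * ?e n) \<longlonglongrightarrow> 2 * C * 0"
      by (intro tendsto_intros LIMSEQ_inverse_real_of_nat)
    then have "\<forall>\<^sub>F n in sequentially. 2 * C * ?e n < \<epsilon>"
      using \<epsilon> by (intro order_tendstoD(2)[of _ 0]) auto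
    then obtain N where N: "2 * C * ?e N < \<epsilon>" by (auto simp: eventually_sequentially)
    have "norm (fs_integral (approximant f m) g - fs_integral (approximant f n) g) < \<epsilon>"
      if "m \<ge> N" "n \<ge> N" for m n
    proof -
      have "?e m \<le> ?e N" "?e n \<le> ?e N" using that by (auto simp: field_simps)
      then have "?e m + ?e n \<le> 2 * ?e N" by linarith
      then have "C * (?e m + ?e n) \<le> C * (2 * ?e N)"
        using C(1) by (rule mult_left_mono)
      then show ?thesis using le[of m n] N by simp
    qed
    then show "\<exists>M. \<forall>m\<ge>M. \<forall>n\<ge>M.
        norm (fs_integral (approximant f m) g - fs_integral (approximant f n) g) < \<epsilon>" by blast
  qed
  then show ?thesis
    using assms by (simp add: inner_prod_def Cauchy_convergent_iff convergent_LIMSEQ_iff)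
qed

text \<open>A second description of the inner product as a limit, symmetric in both arguments;
  through it, symmetry and nonnegativity are inherited from \<open>form\<close>.\<close>

lemma form_tendsto_inner_prod:
  assumes "f \<in> rkhs" "g \<in> rkhs"
  shows "(\<lambda>n. form (approximant f n) (approximant g n)) \<longlonglongrightarrow> inner_prod f g"
proof -
  let ?e = "\<lambda>n. inverse (real (Suc n))"
  obtain C where C: "C \<ge> 0" "\<And>c. \<bar>fs_integral c f\<bar> \<le> C * fnorm c"
    using rkhs_bound[OF assms(1)] by blast
  have "norm (form (approximant f n) (approximant g n) - fs_integral (approximant f n) g)
      \<le> ?e n * (C + 1)" for n
  proof -
    have "fnorm (approximant f n) \<le> C + ?e n"
      by (rule approximates_fnorm_le[OF approximant[OF assms(1)] C(2,1)]) simp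
    also have "\<dots> \<le> C + 1" by (simp add: field_simps)
    finally have "?e n * fnorm (approximant f n) \<le> ?e n * (C + 1)"
      by (intro mult_left_mono) auto
    moreover have "\<bar>fs_integral (approximant f n) g - form (approximant g n) (approximant f n)\<bar>
        \<le> ?e n * fnorm (approximant f n)"
      using approximant[OF assms(2), of n] by (simp add: approximates_def)
    ultimately show ?thesis
      unfolding form_commute[of "approximant g n"] real_norm_def
      by (subst abs_minus_commute) linarith
  qed
  moreover have "(\<lambda>n. ?e n * (C + 1)) \<longlonglongrightarrow> 0"
    using tendsto_mult_right[OF LIMSEQ_inverse_real_of_nat, of "C + 1"] by simp
  ultimately have "(\<lambda>n. form (approximant f n) (approximant g n) - fs_integral (approximant f n) g)
      \<longlonglongrightarrow> 0"
    by (rule Lim_null_comparison[OF always_eventually, OF allI])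
  from tendsto_add[OF this inner_prod_tendsto[OF assms]] show ?thesis by simp
qed

lemma inner_prod_commute: "inner_prod f g = inner_prod g f"
proof (cases "f \<in> rkhs \<and> g \<in> rkhs")
  case True
  then show ?thesis
    using LIMSEQ_unique[OF form_tendsto_inner_prod[of f g]] form_tendsto_inner_prod[of g f]
    by (simp add: form_commute)
qed (auto simp: inner_prod_def)

lemma inner_prod_nonneg: "0 \<le> inner_prod f f"
proof (cases "f \<in> rkhs")
  case True
  then show ?thesis
    by (intro LIMSEQ_le_const[OF form_tendsto_inner_prod]) (auto simp: form_nonneg)
qed (auto simp: inner_prod_def)

lemma inner_prod_add_right:
  assumes "f \<in> rkhs" "g \<in> rkhs" "h \<in> rkhs"
  shows "inner_prod h (\<lambda>x. f x + g x) = inner_prod h f + inner_prod h g"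
  using inner_prod_tendsto[OF assms(3) rkhs_add[OF assms(1,2)]] unfolding fs_integral_add
  by (rule LIMSEQ_unique) (intro tendsto_add inner_prod_tendsto assms)

lemma inner_prod_scale_right:
  assumes "f \<in> rkhs" "h \<in> rkhs"
  shows "inner_prod h (\<lambda>x. t * f x) = t * inner_prod h f"
  using inner_prod_tendsto[OF assms(2) rkhs_scale[OF assms(1)]] unfolding fs_integral_scale
  by (rule LIMSEQ_unique) (intro tendsto_mult_left inner_prod_tendsto assms)

text \<open>With \<open>inner_prod_le\<close> this identifies \<open>sqrt (inner_prod f f)\<close>
  as the least nonnegative bound of \<open>f\<close> as a functional; the distance estimates below
  are all proved as such bounds. Here Cauchy-Schwarz for the approximants is passed to the
  limit.\<close>

lemma inner_prod_bound:
  assumes "f \<in> rkhs"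
  shows "\<bar>fs_integral d f\<bar> \<le> sqrt (inner_prod f f) * fnorm d"
proof -
  let ?e = "\<lambda>n. inverse (real (Suc n))"
  let ?r = "\<lambda>n. sqrt (form (approximant f n) (approximant f n)) * fnorm d + ?e n * fnorm d"
  have "?r \<longlonglongrightarrow> sqrt (inner_prod f f) * fnorm d + 0 * fnorm d"
    by (intro tendsto_intros LIMSEQ_inverse_real_of_nat form_tendsto_inner_prod assms)
  moreover have "\<bar>fs_integral d f\<bar> \<le> ?r n" for n
    using approximant[OF assms, of n, unfolded approximates_def, THEN spec[of _ d]]
      form_Cauchy_Schwarz[of "approximant f n" d]
    unfolding fnorm_def[of "approximant f n", symmetric] by linarith
  ultimately have "\<bar>fs_integral d f\<bar> \<le> sqrt (inner_prod f f) * fnorm d + 0 * fnorm d"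
    by (intro LIMSEQ_le_const[of ?r]) blast+
  then show ?thesis by simp
qed

lemma inner_prod_le:
  assumes "\<And>d. \<bar>fs_integral d f\<bar> \<le> C * fnorm d" "0 \<le> C"
  shows "sqrt (inner_prod f f) \<le> C"
proof -
  have f: "f \<in> rkhs" unfolding rkhs_def using assms(1) by blast
  let ?s = "sqrt (inner_prod f f)"
  have "(\<lambda>n. C * sqrt (form (approximant f n) (approximant f n))) \<longlonglongrightarrow> C * ?s"
    by (intro tendsto_intros form_tendsto_inner_prod f)
  \<comment> \<open>The bound is tested on the approximants of \<open>f\<close> itself; in the limit
    it reads \<open>?s * ?s \<le> C * ?s\<close>.\<close>
  moreover have "\<bar>fs_integral (approximant f n) f\<bar>
      \<le> C * sqrt (form (approximant f n) (approximant f n))" for n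
    using assms(1)[of "approximant f n"] unfolding fnorm_def .
  ultimately have "\<bar>inner_prod f f\<bar> \<le> C * ?s"
    by (intro LIMSEQ_le[OF tendsto_rabs[OF inner_prod_tendsto[OF f f]]]) auto
  then have "?s * ?s \<le> C * ?s"
    using inner_prod_nonneg[of f] by simp
  moreover have "0 \<le> ?s" using inner_prod_nonneg[of f] by (rule real_sqrt_ge_zero)
  ultimately show ?thesis
    using assms(2) mult_right_le_imp_le[of ?s ?s C] by linarith
qed

lemma inner_prod_definite:
  assumes "f \<in> rkhs" "inner_prod f f = 0"
  shows "f = (\<lambda>_. 0)"
proof
  fix x
  show "f x = 0"
    using inner_prod_bound[OF assms(1), of "Poly_Mapping.single x 1"] assms(2) by simp
qed

text \<open>The reproducing property for all measures; point masses give evaluation. As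
  \<open>c\<close> approximates \<open>embed c\<close> with error 0, the chosen approximants tend to
  \<open>c\<close> in the seminorm.\<close>

lemma inner_prod_embed:
  assumes "f \<in> rkhs"
  shows "inner_prod f (embed c) = fs_integral c f"
proof -
  let ?e = "\<lambda>n. inverse (real (Suc n))"
  let ?a = "approximant (embed c)"
  obtain C where C: "C \<ge> 0" "\<And>c. \<bar>fs_integral c f\<bar> \<le> C * fnorm c"
    using rkhs_bound[OF assms] by blast
  have "norm (fs_integral (?a n) f - fs_integral c f) \<le> ?e n * C" for n
  proof -
    have "approximates c 0 (embed c)" by (simp add: approximates_def form_embed)
    then have "fnorm (?a n - c) \<le> ?e n"
      using approximates_fnorm_diff[OF approximant[OF embed_mem, where n = n]] by fastforce
    then have "C * fnorm (?a n - c) \<le> C * ?e n"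
      using C(1) by (intro mult_left_mono)
    then show ?thesis
      using C(2)[of "?a n - c"] by (simp add: fs_integral_diff_measure mult.commute)
  qed
  moreover have "(\<lambda>n. ?e n * C) \<longlonglongrightarrow> 0"
    using tendsto_mult_right[OF LIMSEQ_inverse_real_of_nat, of C] by simp
  ultimately have "(\<lambda>n. fs_integral (?a n) f - fs_integral c f) \<longlonglongrightarrow> 0"
    by (rule Lim_null_comparison[OF always_eventually, OF allI])
  then have "(\<lambda>n. fs_integral (?a n) f) \<longlonglongrightarrow> fs_integral c f"
    by (simp add: LIM_zero_iff)
  then show ?thesis
    using LIMSEQ_unique[OF inner_prod_tendsto[OF embed_mem assms]] inner_prod_commute by metis
qed

section \<open>Metric and completeness\<close>

abbreviation hdist :: "('p \<Rightarrow> real) \<Rightarrow> ('p \<Rightarrow> real) \<Rightarrow> real" where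
  "hdist f g \<equiv> sqrt (inner_prod (\<lambda>x. f x - g x) (\<lambda>x. f x - g x))"

lemma hdist_le:
  assumes "\<And>d. \<bar>fs_integral d f - fs_integral d g\<bar> \<le> C * fnorm d" "0 \<le> C"
  shows "hdist f g \<le> C"
  using assms by (intro inner_prod_le) (simp add: fs_integral_diff)

lemma hdist_bound:
  assumes "f \<in> rkhs" "g \<in> rkhs"
  shows "\<bar>fs_integral d f - fs_integral d g\<bar> \<le> hdist f g * fnorm d"
  using inner_prod_bound[OF rkhs_diff[OF assms], of d] by (simp add: fs_integral_diff)

lemma Metric_space_rkhs: "Metric_space rkhs hdist"
proof
  fix f g
  show "0 \<le> hdist f g" by (simp add: inner_prod_nonneg)
  \<comment> \<open>Symmetry is required for arbitrary functions, not only for members. The two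
    differences lie in \<open>rkhs\<close> together; when they do not, both distances are the
    default 0.\<close>
  have "(\<lambda>x. f x - g x) \<in> rkhs \<longleftrightarrow> (\<lambda>x. g x - f x) \<in> rkhs"
    using rkhs_scale[of "\<lambda>x. f x - g x" "-1"] rkhs_scale[of "\<lambda>x. g x - f x" "-1"] by auto
  moreover have "hdist f g \<le> hdist g f" if "(\<lambda>x. g x - f x) \<in> rkhs" for f g
    using inner_prod_bound[OF that] inner_prod_nonneg
    by (intro hdist_le) (simp_all add: fs_integral_diff abs_minus_commute)
  moreover have "hdist f g = 0" if "(\<lambda>x. f x - g x) \<notin> rkhs" for f g
    using that by (simp add: inner_prod_def)
  ultimately show "hdist f g = hdist g f"
    using antisym[of "hdist f g" "hdist g f"] by (cases "(\<lambda>x. f x - g x) \<in> rkhs") simp_all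
next
  fix f g assume fg: "f \<in> rkhs" "g \<in> rkhs"
  show "hdist f g = 0 \<longleftrightarrow> f = g"
  proof
    assume "hdist f g = 0"
    then have "(\<lambda>x. f x - g x) = (\<lambda>_. 0)"
      by (intro inner_prod_definite rkhs_diff fg) simp
    then show "f = g" by (metis eq_iff_diff_eq_0 ext)
  next
    assume "f = g"
    then have "hdist f g \<le> 0" by (intro hdist_le) auto
    then show "hdist f g = 0" using inner_prod_nonneg[of "\<lambda>x. f x - g x"] by auto
  qed
  fix h assume h: "h \<in> rkhs"
  show "hdist f h \<le> hdist f g + hdist g h"
  proof (rule hdist_le)
    fix d
    show "\<bar>fs_integral d f - fs_integral d h\<bar> \<le> (hdist f g + hdist g h) * fnorm d"
      using hdist_bound[OF fg, of d] hdist_bound[OF fg(2) h, of d]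
      unfolding distrib_right by linarith
  qed (simp add: inner_prod_nonneg)
qed

text \<open>The limit is taken pointwise. The Cauchy estimates, read as bounds against measures
  \<open>d\<close>, are uniform in \<open>d\<close>, so they survive the limit and give convergence
  in norm.\<close>

lemma rkhs_mcomplete: "Metric_space.mcomplete rkhs hdist"
proof -
  interpret Metric_space rkhs hdist by (rule Metric_space_rkhs)
  show ?thesis unfolding mcomplete_def
  proof (intro allI impI)
    fix \<sigma> assume Cau: "MCauchy \<sigma>"
    then have mem: "\<sigma> n \<in> rkhs" for n by (auto simp: MCauchy_def)
    have small: "\<exists>N. \<forall>m n. N \<le> m \<longrightarrow> N \<le> n \<longrightarrow> hdist (\<sigma> m) (\<sigma> n) < \<epsilon>" if "\<epsilon> > 0" for \<epsilon>
      using Cau[unfolded MCauchy_def, THEN conjunct2, rule_format, OF that] .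
    have conv: "convergent (\<lambda>n. \<sigma> n x)" for x
    proof -
      let ?k = "fnorm (Poly_Mapping.single x 1)"
      have "Cauchy (\<lambda>n. \<sigma> n x)"
      proof (rule CauchyI)
        fix \<epsilon> :: real assume "\<epsilon> > 0"
        then obtain N where N: "\<And>m n. m \<ge> N \<Longrightarrow> n \<ge> N \<Longrightarrow> hdist (\<sigma> m) (\<sigma> n) < \<epsilon> / (?k + 1)"
          using small[of "\<epsilon> / (?k + 1)"] fnorm_nonneg[of "Poly_Mapping.single x 1"] by auto
        have "norm (\<sigma> m x - \<sigma> n x) < \<epsilon>" if "m \<ge> N" "n \<ge> N" for m n
        proof -
          have "norm (\<sigma> m x - \<sigma> n x) \<le> hdist (\<sigma> m) (\<sigma> n) * ?k"
            using hdist_bound[OF mem mem, of "Poly_Mapping.single x 1" m n] by simp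
          also have "\<dots> \<le> hdist (\<sigma> m) (\<sigma> n) * (?k + 1)"
            by (intro mult_left_mono) (auto simp: inner_prod_nonneg)
          also have "\<dots> < \<epsilon>"
            using N[OF that] fnorm_nonneg[of "Poly_Mapping.single x 1"] by (simp add: field_simps)
          finally show ?thesis .
        qed
        then show "\<exists>M. \<forall>m\<ge>M. \<forall>n\<ge>M. norm (\<sigma> m x - \<sigma> n x) < \<epsilon>" by blast
      qed
      then show ?thesis by (simp add: Cauchy_convergent_iff)
    qed
    define f where "f = (\<lambda>x. lim (\<lambda>n. \<sigma> n x))"
    have "(\<lambda>n. \<sigma> n x) \<longlonglongrightarrow> f x" for x
      using conv by (simp add: f_def convergent_LIMSEQ_iff)
    then have lim: "(\<lambda>n. fs_integral d (\<sigma> n)) \<longlonglongrightarrow> fs_integral d f" for d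
      unfolding fs_integral_def by (intro tendsto_intros)
    have close: "\<exists>N. \<forall>n\<ge>N. \<forall>d. \<bar>fs_integral d (\<sigma> n) - fs_integral d f\<bar> \<le> \<epsilon> * fnorm d"
      if \<epsilon>: "\<epsilon> > 0" for \<epsilon>
    proof -
      obtain N where N: "\<And>m n. m \<ge> N \<Longrightarrow> n \<ge> N \<Longrightarrow> hdist (\<sigma> m) (\<sigma> n) < \<epsilon>"
        using small[OF \<epsilon>] by blast
      have "\<bar>fs_integral d (\<sigma> n) - fs_integral d f\<bar> \<le> \<epsilon> * fnorm d" if "n \<ge> N" for n d
      proof (rule LIMSEQ_le_const2)
        show "(\<lambda>m. \<bar>fs_integral d (\<sigma> n) - fs_integral d (\<sigma> m)\<bar>)
            \<longlonglongrightarrow> \<bar>fs_integral d (\<sigma> n) - fs_integral d f\<bar>"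
          by (intro tendsto_intros lim)
        have "\<bar>fs_integral d (\<sigma> n) - fs_integral d (\<sigma> m)\<bar> \<le> \<epsilon> * fnorm d" if "m \<ge> N" for m
          using hdist_bound[OF mem mem, of d n m] N[OF \<open>n \<ge> N\<close> that] fnorm_nonneg[of d]
            mult_right_mono[of "hdist (\<sigma> n) (\<sigma> m)" \<epsilon> "fnorm d"] by linarith
        then show "\<exists>N. \<forall>m\<ge>N. \<bar>fs_integral d (\<sigma> n) - fs_integral d (\<sigma> m)\<bar> \<le> \<epsilon> * fnorm d"
          by blast
      qed
      then show ?thesis by blast
    qed
    obtain N where "\<And>d. \<bar>fs_integral d (\<sigma> N) - fs_integral d f\<bar> \<le> 1 * fnorm d"
      using close[of 1] by auto
    \<comment> \<open>The difference has the finite bound 1, hence lies in the space; subtracting it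
      from \<open>\<sigma> N\<close> shows that \<open>f\<close> does too.\<close>
    then have "(\<lambda>x. \<sigma> N x - f x) \<in> rkhs"
      unfolding rkhs_def by (intro CollectI exI[of _ 1] allI) (simp add: fs_integral_diff)
    from rkhs_diff[OF mem[of N] this] have f: "f \<in> rkhs" by simp
    have "\<exists>N. \<forall>n\<ge>N. hdist (\<sigma> n) f < \<epsilon>" if "\<epsilon> > 0" for \<epsilon>
    proof -
      obtain N where "\<And>n d. n \<ge> N \<Longrightarrow> \<bar>fs_integral d (\<sigma> n) - fs_integral d f\<bar> \<le> \<epsilon> / 2 * fnorm d"
        using close[OF half_gt_zero[OF \<open>\<epsilon> > 0\<close>]] by blast
      then have "hdist (\<sigma> n) f \<le> \<epsilon> / 2" if "n \<ge> N" for n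
        using that \<open>\<epsilon> > 0\<close> by (intro hdist_le) auto
      then show ?thesis using that by (intro exI[of _ N]) fastforce
    qed
    then show "\<exists>x. limitin mtopology \<sigma> x sequentially"
      using f mem by (auto simp: limitin_metric eventually_sequentially intro!: exI[of _ f])
  qed
qed

end

section \<open>Spaces over a subset and norms of embedded measures\<close>

lemma reproducing_kernel_hilbert_space_exists:
  fixes K :: "'p \<Rightarrow> 'p \<Rightarrow> real"
  assumes sym: "\<And>x y. x \<in> S \<Longrightarrow> y \<in> S \<Longrightarrow> K x y = K y x"
    and psd: "\<And>A c. finite A \<Longrightarrow> A \<subseteq> S \<Longrightarrow> 0 \<le> (\<Sum>x\<in>A. \<Sum>y\<in>A. c x * c y * K x y)"
  shows "\<exists>H ip. reproducing_kernel_hilbert_space S H ip K"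
proof -
  define L where "L = (\<lambda>x y. if x \<in> S \<and> y \<in> S then K x y else 0)"
  interpret psd_kernel L
  proof
    show "L x y = L y x" for x y using sym by (auto simp: L_def)
    fix A :: "'p set" and c :: "'p \<Rightarrow> real"
    assume A: "finite A"
    have "(\<Sum>x\<in>A. \<Sum>y\<in>A. c x * c y * L x y) = (\<Sum>x\<in>A. \<Sum>y\<in>A\<inter>S. c x * c y * L x y)"
      using A by (intro sum.cong refl sum.mono_neutral_right) (auto simp: L_def)
    also have "\<dots> = (\<Sum>x\<in>A\<inter>S. \<Sum>y\<in>A\<inter>S. c x * c y * L x y)"
      using A by (intro sum.mono_neutral_right) (auto simp: L_def intro!: sum.neutral)
    also have "\<dots> = (\<Sum>x\<in>A\<inter>S. \<Sum>y\<in>A\<inter>S. c x * c y * K x y)"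
      by (intro sum.cong) (auto simp: L_def)
    also have "\<dots> \<ge> 0" using A by (intro psd) auto
    finally show "0 \<le> (\<Sum>x\<in>A. \<Sum>y\<in>A. c x * c y * L x y)" .
  qed
  have sec: "kernel_section S K x = embed (Poly_Mapping.single x 1)" if "x \<in> S" for x
    unfolding kernel_section_def embed_def fs_integral_single
    using that sym by (auto simp: L_def fun_eq_iff)
  have "reproducing_kernel_hilbert_space S rkhs inner_prod K"
  proof
    fix f x assume fx: "f \<in> rkhs" "x \<notin> S"
    \<comment> \<open>Outside \<open>S\<close> a point mass has seminorm 0, so every bounded
      functional vanishes on it.\<close>
    have "L x x = 0" using fx(2) by (simp add: L_def)
    then have "fnorm (Poly_Mapping.single x 1) = 0" by (simp add: fnorm_def form_def)
    then show "f x = 0"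
      using inner_prod_bound[OF fx(1), of "Poly_Mapping.single x 1"] by simp
  next
    show "inner_prod (\<lambda>x. f x + g x) h = inner_prod f h + inner_prod g h"
      if "f \<in> rkhs" "g \<in> rkhs" "h \<in> rkhs" for f g h
      using inner_prod_add_right[OF that] by (simp add: inner_prod_commute)
    show "inner_prod (\<lambda>x. c * f x) g = c * inner_prod f g" if "f \<in> rkhs" "g \<in> rkhs" for c f g
      using inner_prod_scale_right[OF that] by (simp add: inner_prod_commute)
  qed (simp_all add: rkhs_zero rkhs_add rkhs_scale inner_prod_commute inner_prod_nonneg
        inner_prod_definite rkhs_mcomplete sec embed_mem inner_prod_embed)
  then show ?thesis by blast
qed

text \<open>Stated for an arbitrary reproducing kernel Hilbert space, since the space picked by
  \<open>the_rkhs\<close> is known only through its axioms.\<close>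

lemma (in reproducing_kernel_hilbert_space) sum_sections:
  assumes "finite A" "A \<subseteq> S"
  shows "(\<lambda>y. \<Sum>x\<in>A. c x * kernel_section S K x y) \<in> H"
    and "f \<in> H \<Longrightarrow> ip (\<lambda>y. \<Sum>x\<in>A. c x * kernel_section S K x y) f = (\<Sum>x\<in>A. c x * f x)"
  using assms
proof (induction A rule: finite_induct)
  case empty
  { case 1 show ?case using zero_mem by simp }
  { case 2 then show ?case using ip_scale_left[OF zero_mem, of f 0] by simp }
next
  case (insert a A)
  { case 1 then show ?case
      using insert by (simp add: add_mem scale_mem section_mem) }
  { case 2 then show ?case
      using insert reproducing[of f a]
      by (simp add: ip_add_left scale_mem section_mem ip_scale_left ip_commute[of _ f]) }
qed

text \<open>Existence makes the choice in \<open>the_rkhs\<close> legitimate. The embedding is a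
  finite combination of sections, so the reproducing property yields its norm in whichever space was
  chosen.\<close>

lemma rkhs_norm_kernel_embedding:
  assumes sym: "\<And>x y. x \<in> S \<Longrightarrow> y \<in> S \<Longrightarrow> K x y = K y x"
    and psd: "\<And>A c. finite A \<Longrightarrow> A \<subseteq> S \<Longrightarrow> 0 \<le> (\<Sum>x\<in>A. \<Sum>y\<in>A. c x * c y * K x y)"
    and keys: "Poly_Mapping.keys \<mu> \<subseteq> S"
  shows "(rkhs_norm S K (kernel_embedding S K \<mu>))\<^sup>2
    = fs_integral \<mu> (\<lambda>x. fs_integral \<mu> (\<lambda>y. K x y))"
proof -
  have "\<exists>R. reproducing_kernel_hilbert_space S (fst R) (snd R) K"
    using reproducing_kernel_hilbert_space_exists[of S K] sym psd by auto
  then have "reproducing_kernel_hilbert_space S (fst (the_rkhs S K)) (snd (the_rkhs S K)) K"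
    unfolding the_rkhs_def by (rule someI_ex)
  then interpret reproducing_kernel_hilbert_space S "fst (the_rkhs S K)" "snd (the_rkhs S K)" K .
  let ?f = "kernel_embedding S K \<mu>"
  have f: "?f = (\<lambda>y. \<Sum>x\<in>Poly_Mapping.keys \<mu>. Poly_Mapping.lookup \<mu> x * kernel_section S K x y)"
    by (auto simp: kernel_embedding_def kernel_section_def fs_integral_def fun_eq_iff mult.commute)
  have mem: "?f \<in> fst (the_rkhs S K)"
    unfolding f by (rule sum_sections(1)) (use keys in auto)
  have "snd (the_rkhs S K) ?f ?f = (\<Sum>x\<in>Poly_Mapping.keys \<mu>. Poly_Mapping.lookup \<mu> x * ?f x)"
    by (subst (1) f, rule sum_sections(2)[OF _ keys mem]) simp
  also have "\<dots> = fs_integral \<mu> (\<lambda>x. fs_integral \<mu> (\<lambda>y. K x y))"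
    unfolding fs_integral_def kernel_embedding_def
    by (intro sum.cong refl) (use keys in \<open>auto simp: mult.commute\<close>)
  finally show ?thesis
    using ip_nonneg[OF mem] by (simp add: rkhs_norm_def)
qed


section \<open>Measures with vanishing marginals\<close>

lemma splice_apply:
  "splice n F x y i = (if i \<in> F then x i else if i \<in> {1..n} then y i else undefined)"
  by (simp add: splice_def merge_def)

lemma splice_mem:
  assumes "F \<subseteq> {1..n}" "\<And>i. i \<in> F \<Longrightarrow> x i \<in> X i" "\<And>i. i \<in> {1..n} - F \<Longrightarrow> y i \<in> X i"
  shows "splice n F x y \<in> PiE {1..n} X"
  using assms by (auto simp: splice_apply PiE_iff extensional_def)

lemma splice_PiE:
  assumes "F \<subseteq> {1..n}" "x \<in> PiE {1..n} X" "y \<in> PiE {1..n} X"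
  shows "splice n F x y \<in> PiE {1..n} X"
  using assms by (intro splice_mem) (auto simp: PiE_iff)

text \<open>Group the support of \<open>\<mu>\<close> by restriction to \<open>B\<close>. Each group
  is cut out by a box with one-point sides on \<open>B\<close> and full sides elsewhere; such a box
  has measure 0, and \<open>f\<close> is constant on it.\<close>

lemma M_space_integral_eq_0:
  assumes \<mu>: "\<mu> \<in> M_space k N Z" and B: "B \<subseteq> {1..N}" "card B < k"
    and f: "\<And>x y. x \<in> PiE {1..N} Z \<Longrightarrow> y \<in> PiE {1..N} Z \<Longrightarrow> (\<And>i. i \<in> B \<Longrightarrow> x i = y i) \<Longrightarrow> f x = f y"
  shows "fs_integral \<mu> f = 0"
proof -
  let ?P = "Poly_Mapping.keys \<mu>"
  let ?g = "\<lambda>x. restrict x B"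
  have P: "?P \<subseteq> PiE {1..N} Z" using \<mu> by (simp add: M_space_def)
  have "(\<Sum>x | x \<in> ?P \<and> ?g x = u. f x * Poly_Mapping.lookup \<mu> x) = 0" if u: "u \<in> ?g ` ?P" for u
  proof -
    obtain p where p: "p \<in> ?P" "u = ?g p" using u by blast
    define A where "A = (\<lambda>i. if i \<in> B then {p i} else Z i)"
    have eq: "{x \<in> ?P. ?g x = u} = ?P \<inter> PiE {1..N} A"
    proof (intro set_eqI iffI)
      fix x assume x: "x \<in> {x \<in> ?P. ?g x = u}"
      then have "x \<in> PiE {1..N} Z" and "?g x = ?g p" using P p(2) by auto
      moreover have "x i = p i" if "i \<in> B" for i
        using fun_cong[OF \<open>?g x = ?g p\<close>, of i] that by simp
      ultimately show "x \<in> ?P \<inter> PiE {1..N} A" using x by (auto simp: A_def PiE_iff)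
    next
      fix x assume x: "x \<in> ?P \<inter> PiE {1..N} A"
      have "x i = p i" if "i \<in> B" for i
      proof -
        have "x i \<in> A i" using x that B(1) by (auto simp: PiE_iff)
        then show ?thesis using that by (simp add: A_def)
      qed
      then show "x \<in> {x \<in> ?P. ?g x = u}"
        using x p(2) by (auto simp: restrict_def fun_eq_iff)
    qed
    \<comment> \<open>Only an inclusion: a side over \<open>B\<close> is full as well when
      \<open>Z i\<close> is a singleton.\<close>
    have "{1..N} - B \<subseteq> {i \<in> {1..N}. A i = Z i}" by (auto simp: A_def)
    then have "card ({1..N} - B) \<le> card {i \<in> {1..N}. A i = Z i}"
      by (intro card_mono) auto
    moreover have "card ({1..N} - B) + card B = N"
      using B(1) card_mono[OF _ B(1)] by (subst card_Diff_subset) (auto intro: finite_subset)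
    ultimately have "N + 1 \<le> card {i \<in> {1..N}. A i = Z i} + k" using B(2) by linarith
    moreover have "\<forall>i\<in>{1..N}. A i \<subseteq> Z i"
      using p(1) P by (auto simp: A_def PiE_iff)
    ultimately have "meas \<mu> (PiE {1..N} A) = 0"
      using \<mu> by (simp add: M_space_def)
    moreover have "f x = f p" if "x \<in> {x \<in> ?P. ?g x = u}" for x
    proof (rule f)
      show "x \<in> PiE {1..N} Z" "p \<in> PiE {1..N} Z" using that P p(1) by auto
      show "x i = p i" if "i \<in> B" for i
      proof -
        have "?g x = ?g p" using \<open>x \<in> {x \<in> ?P. ?g x = u}\<close> p(2) by simp
        from fun_cong[OF this, of i] show ?thesis using that by simp
      qed
    qed
    then have "(\<Sum>x\<in>{x \<in> ?P. ?g x = u}. f x * Poly_Mapping.lookup \<mu> x)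
        = (\<Sum>x\<in>{x \<in> ?P. ?g x = u}. f p * Poly_Mapping.lookup \<mu> x)"
      by (intro sum.cong) auto
    then have "(\<Sum>x\<in>{x \<in> ?P. ?g x = u}. f x * Poly_Mapping.lookup \<mu> x) = f p * meas \<mu> (PiE {1..N} A)"
      unfolding eq by (simp add: meas_def sum_distrib_left)
    ultimately show ?thesis by simp
  qed
  then have "(\<Sum>u\<in>?g ` ?P. \<Sum>x | x \<in> ?P \<and> ?g x = u. f x * Poly_Mapping.lookup \<mu> x) = 0"
    by (intro sum.neutral) blast
  then show ?thesis
    unfolding fs_integral_def by (subst (asm) sum.group) auto
qed

text \<open>Converse of \<open>M_space_integral_eq_0\<close>: the indicator of a box depends only on
  the coordinates whose side is not full, and there are fewer than \<open>k\<close> of them.\<close>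

lemma M_spaceI:
  assumes keys: "Poly_Mapping.keys \<mu> \<subseteq> PiE {1..N} Z"
    and zero: "\<And>B f. B \<subseteq> {1..N} \<Longrightarrow> card B < k \<Longrightarrow>
      (\<And>x y. x \<in> PiE {1..N} Z \<Longrightarrow> y \<in> PiE {1..N} Z \<Longrightarrow> (\<And>i. i \<in> B \<Longrightarrow> x i = y i) \<Longrightarrow> f x = f y) \<Longrightarrow>
      fs_integral \<mu> f = 0"
  shows "\<mu> \<in> M_space k N Z"
  unfolding M_space_def
proof (intro CollectI conjI keys allI impI)
  fix A assume A: "(\<forall>i\<in>{1..N}. A i \<subseteq> Z i) \<and> N + 1 \<le> card {i \<in> {1..N}. A i = Z i} + k"
  let ?B = "{i \<in> {1..N}. A i \<noteq> Z i}"
  have "card {i \<in> {1..N}. A i = Z i} + card ?B = card {1..N}"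
    by (subst card_Un_disjoint[symmetric]) (auto intro!: arg_cong[where f = card] simp del: card_atLeastAtMost)
  then have card: "card ?B < k" using A by simp
  have iff: "x \<in> PiE {1..N} A \<longleftrightarrow> y \<in> PiE {1..N} A"
    if "x \<in> PiE {1..N} Z" "y \<in> PiE {1..N} Z" "\<And>i. i \<in> ?B \<Longrightarrow> x i = y i" for x y
  proof -
    have "x i \<in> A i \<longleftrightarrow> y i \<in> A i" if "i \<in> {1..N}" for i
      using that \<open>x \<in> _\<close> \<open>y \<in> _\<close> \<open>\<And>i. i \<in> ?B \<Longrightarrow> x i = y i\<close>[of i] by (cases "A i = Z i") (auto simp: PiE_iff)
    then show ?thesis using that(1,2) by (auto simp: PiE_iff)
  qed
  have "fs_integral \<mu> (indicator (PiE {1..N} A)) = 0"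
  proof (rule zero[OF _ card])
    show "indicator (PiE {1..N} A) x = (indicator (PiE {1..N} A) y :: real)"
      if "x \<in> PiE {1..N} Z" "y \<in> PiE {1..N} Z" "\<And>i. i \<in> ?B \<Longrightarrow> x i = y i" for x y
      using iff[OF that] by (simp add: indicator_def)
  qed auto
  then show "meas \<mu> (PiE {1..N} A) = 0" by (simp add: meas_eq_fs_integral)
qed


section \<open>The measures that define the kernel\<close>

text \<open>The \<open>m\<close>-th finite difference of a polynomial of degree \<open>r < m\<close>
  vanishes. The generalised binomial stays polynomial at negative arguments;
  \<open>mu_meas_coefficient\<close> uses it at -1.\<close>

lemma gbinomial_alternating_sum:
  fixes y :: real
  shows "r < m \<Longrightarrow> (\<Sum>i\<le>m. (-1) ^ i * real (m choose i) * ((y - real i) gchoose r)) = 0"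
proof (induction m arbitrary: y r)
  case 0
  then show ?case by simp
next
  case (Suc m)
  let ?S = "\<lambda>m y r. \<Sum>i\<le>m. (-1) ^ i * real (m choose i) * ((y - real i) gchoose r)"
  have ext: "(\<Sum>i\<le>Suc m. (-1) ^ i * real (m choose i) * ((y - real i) gchoose r)) = ?S m y r"
    by simp
  \<comment> \<open>Pascal's rule in \<open>m\<close> turns the sum into a backward difference in
    \<open>y\<close>, which below lowers \<open>r\<close> by one.\<close>
  have "?S (Suc m) y r = (y gchoose r) + (\<Sum>i\<le>m. (-1) ^ Suc i * real (Suc m choose Suc i) * ((y - real (Suc i)) gchoose r))"
    by (subst sum.atMost_Suc_shift) simp
  also have "\<dots> = (y gchoose r) + (\<Sum>i\<le>m. (-1) ^ Suc i * real (m choose Suc i) * ((y - real (Suc i)) gchoose r))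
      - (\<Sum>i\<le>m. (-1) ^ i * real (m choose i) * ((y - real (Suc i)) gchoose r))"
    by (simp add: sum.distrib[symmetric] algebra_simps flip: sum_subtractf sum_negf)
  also have "(y gchoose r) + (\<Sum>i\<le>m. (-1) ^ Suc i * real (m choose Suc i) * ((y - real (Suc i)) gchoose r))
      = ?S m y r"
    by (subst ext[symmetric], subst sum.atMost_Suc_shift) simp
  also have "(\<Sum>i\<le>m. (-1) ^ i * real (m choose i) * ((y - real (Suc i)) gchoose r)) = ?S m (y - 1) r"
    by (simp add: algebra_simps)
  finally have rec: "?S (Suc m) y r = ?S m y r - ?S m (y - 1) r" .
  show ?case
  proof (cases r)
    case 0
    have "?S m y r - ?S m (y - 1) r = 0" using 0 by simp
    then show ?thesis using rec by simp
  next
    case (Suc r')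
    have "((y - real i) gchoose r) - ((y - 1 - real i) gchoose r) = ((y - 1 - real i) gchoose r')" for i
      using gbinomial_addition_formula[of "y - real i" r'] Suc by (simp add: algebra_simps)
    then have "?S m y r - ?S m (y - 1) r = ?S m (y - 1) r'"
      by (simp flip: sum_subtractf right_diff_distrib)
    then show ?thesis using rec Suc.IH[of r' "y - 1"] Suc.prems Suc by simp
  qed
qed

text \<open>For \<open>E \<subseteq> B\<close> of sizes \<open>e\<close> and \<open>b\<close> this
  is the total weight in \<open>mu_meas\<close> of the sets \<open>F\<close> of size below
  \<open>k\<close> with \<open>F \<inter> B = E\<close>. Put \<open>i = j - e\<close>: the
  alternating sum over \<open>i \<le> n - e\<close> vanishes, its terms with
  \<open>k - e \<le> i < n - e\<close> are zero since their upper argument is below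
  \<open>n - k\<close>, and the term at \<open>n - e\<close> is nonzero only for
  \<open>e = b\<close>.\<close>

lemma mu_meas_coefficient:
  assumes "b < k" "k \<le> n" "e \<le> b"
  shows "(\<Sum>j<k. (-1) ^ (k - j) * real ((n - j - 1) choose (n - k))
            * real (if e \<le> j then (n - b) choose (j - e) else 0)) = (if e = b then -1 else 0)"
proof -
  define r m where "r = n - k" and "m = n - b"
  let ?y = "real n - real e - 1"
  let ?t = "\<lambda>i. (-1) ^ i * real (m choose i) * ((?y - real i) gchoose r)"
  have mr: "r < m" "m \<le> n - e" "k - e \<le> n - e" using assms by (auto simp: r_def m_def)
  \<comment> \<open>At \<open>i = n - e\<close> truncated subtraction would give 0 in place of -1,
    so that term is treated apart.\<close>
  have gb: "((?y - real i) gchoose r) = real ((n - e - i - 1) choose r)" if "i < n - e" for i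
  proof -
    have "?y - real i = real (n - e - i - 1)" using that assms by (simp add: of_nat_diff)
    then show ?thesis by (simp only: binomial_gbinomial)
  qed
  have "0 = (\<Sum>i\<le>m. ?t i)" using gbinomial_alternating_sum[OF mr(1)] by simp
  also have "\<dots> = (\<Sum>i\<le>n - e. ?t i)"
    using mr by (intro sum.mono_neutral_left) auto
  also have "\<dots> = (\<Sum>i<n - e. ?t i) + ?t (n - e)"
    by (simp add: lessThan_Suc_atMost[symmetric])
  also have "?t (n - e) = (if e = b then (-1) ^ (n - e + r) else 0)"
  proof (cases "e = b")
    case True
    have "((-1::real) gchoose r) = (-1) ^ r"
      using gbinomial_minus[of "1::real" r] by (simp add: gbinomial_of_nat_symmetric flip: binomial_gbinomial)
    moreover have "?y - real (n - e) = -1" "m choose (n - e) = 1"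
      using True assms by (simp_all add: m_def of_nat_diff)
    ultimately show ?thesis using True by (simp only: power_add) simp
  next
    case False
    then have "m < n - e" using assms by (simp add: m_def)
    then show ?thesis using False by simp
  qed
  also have "(\<Sum>i<n - e. ?t i) = (\<Sum>i<k - e. ?t i)"
  proof (rule sum.mono_neutral_right)
    show "\<forall>i\<in>{..<n - e} - {..<k - e}. ?t i = 0"
      using gb by (auto simp: r_def)
  qed (use mr in auto)
  finally have eq: "(\<Sum>i<k - e. ?t i) = (if e = b then - ((-1) ^ (n - e + r)) else 0)"
    by (auto split: if_splits)
  have "(\<Sum>j<k. (-1) ^ (k - j) * real ((n - j - 1) choose (n - k))
            * real (if e \<le> j then (n - b) choose (j - e) else 0))
      = (\<Sum>j\<in>{e..<k}. (-1) ^ (k - j) * real ((n - j - 1) choose r) * real (m choose (j - e)))"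
    unfolding r_def m_def by (intro sum.mono_neutral_cong_right) auto
  also have "\<dots> = (\<Sum>i<k - e. (-1) ^ (k - (i + e)) * real ((n - (i + e) - 1) choose r) * real (m choose i))"
    using sum.shift_bounds_nat_ivl[of "\<lambda>j. (-1) ^ (k - j) * real ((n - j - 1) choose r) * real (m choose (j - e))" 0 e "k - e"]
      assms by (simp add: atLeast0LessThan)
  also have "\<dots> = (\<Sum>i<k - e. (-1) ^ (k - e) * ?t i)"
  proof (intro sum.cong refl)
    fix i assume i: "i \<in> {..<k - e}"
    have "(-1::real) ^ (k - (i + e)) = (-1) ^ (k - e) * (-1) ^ i"
    proof -
      have "(-1::real) ^ (k - e) = (-1) ^ (k - (i + e)) * (-1) ^ i"
        using i by (subst power_add[symmetric]) (simp add: add.commute)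
      moreover have "(-1::real) ^ i * (-1) ^ i = 1" by (simp flip: power_mult_distrib)
      ultimately show ?thesis by (simp add: mult.assoc)
    qed
    moreover have "n - (i + e) - 1 = n - e - i - 1" by simp
    ultimately show "(-1) ^ (k - (i + e)) * real ((n - (i + e) - 1) choose r) * real (m choose i)
        = (-1) ^ (k - e) * ?t i"
      using gb[of i] i assms by (simp only: mult_ac) auto
  qed
  also have "\<dots> = (-1) ^ (k - e) * (if e = b then - ((-1) ^ (n - e + r)) else 0)"
    by (simp only: sum_distrib_left[symmetric] eq)
  also have "\<dots> = (if e = b then -1 else 0)"
  proof -
    have "(-1::real) ^ (k - e) * (-1) ^ (n - e + r) = (-1) ^ (2 * (n - e))"
      using assms by (simp add: r_def flip: power_add)
    then show ?thesis by (cases "e = b") simp_all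
  qed
  finally show ?thesis .
qed

text \<open>\<open>F\<close> is determined by its part outside \<open>B\<close>. With
  \<open>E = B\<close> the formula counts the supersets of \<open>B\<close>.\<close>

lemma card_subsets_with_trace:
  assumes "B \<subseteq> {1..n}" "E \<subseteq> B"
  shows "card {F. F \<subseteq> {1..n} \<and> card F = j \<and> F \<inter> B = E}
    = (if card E \<le> j then (n - card B) choose (j - card E) else 0)"
proof -
  have "finite B" using finite_subset[OF assms(1)] by simp
  moreover from this have "finite E" using finite_subset[OF assms(2)] by simp
  ultimately have fin: "finite B" "finite E" .
  have card_Un: "card (E \<union> G) = card E + card G" if "G \<subseteq> {1..n} - B" for G
  proof (rule card_Un_disjoint)
    show "finite G" using finite_subset[OF that] by simp
  qed (use that fin assms(2) in auto)
  show ?thesis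
  proof (cases "card E \<le> j")
    case True
    have "{F. F \<subseteq> {1..n} \<and> card F = j \<and> F \<inter> B = E}
        = (\<union>) E ` {G. G \<subseteq> {1..n} - B \<and> card G = j - card E}" (is "?L = ?R")
    proof (intro set_eqI iffI)
      fix F assume F: "F \<in> ?L"
      then have eq: "F = E \<union> (F - B)" by auto
      have "card (E \<union> (F - B)) = card E + card (F - B)"
        using F by (intro card_Un) auto
      moreover have "card F = j" using F by simp
      ultimately have "card (F - B) = j - card E" using eq by (metis diff_add_inverse)
      then have "F - B \<in> {G. G \<subseteq> {1..n} - B \<and> card G = j - card E}" using F by auto
      then show "F \<in> ?R" using eq by (rule rev_image_eqI)
    next
      fix F assume "F \<in> ?R"
      then obtain G where G: "F = E \<union> G" "G \<subseteq> {1..n} - B" "card G = j - card E" by auto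
      then have "card F = j" using card_Un[OF G(2)] True by simp
      moreover have "F \<subseteq> {1..n}" "F \<inter> B = E" using G assms by auto
      ultimately show "F \<in> ?L" by simp
    qed
    moreover have "inj_on ((\<union>) E) {G. G \<subseteq> {1..n} - B \<and> card G = j - card E}"
      using assms(2) by (auto simp: inj_on_def)
    moreover have "card ({1..n} - B) = n - card B"
      using assms(1) fin by (simp add: card_Diff_subset)
    ultimately show ?thesis
      using True by (simp add: card_image n_subsets)
  next
    case False
    have "card E \<le> card F" if "F \<subseteq> {1..n}" "F \<inter> B = E" for F
      using that finite_subset[OF that(1)] by (intro card_mono) auto
    then have "{F. F \<subseteq> {1..n} \<and> card F = j \<and> F \<inter> B = E} = {}" using False by auto
    then show ?thesis using False by simp
  qed
qed

section \<open>Integrals against \<open>mu_meas\<close>\<close>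

lemma fs_integral_mu_meas:
  "fs_integral (mu_meas k n x x0) f = f x +
    (\<Sum>j<k. (-1) ^ (k - j) * real ((n - j - 1) choose (n - k)) *
      (\<Sum>F | F \<subseteq> {1..n} \<and> card F = j. f (splice n F x x0)))"
  by (simp add: mu_meas_def fs_integral_add_measure fs_integral_sum_measure sum_distrib_left mult_ac)

text \<open>Group the sets \<open>F\<close> by their trace \<open>E\<close> on \<open>B\<close>,
  which alone determines the value of \<open>f\<close>. By \<open>mu_meas_coefficient\<close> only
  \<open>E = B\<close> keeps a weight, namely -1, and this cancels the point mass at
  \<open>x\<close>.\<close>

lemma fs_integral_mu_meas_eq_0:
  assumes "k \<le> n" "x \<in> PiE {1..n} X" "x0 \<in> PiE {1..n} X" and B: "B \<subseteq> {1..n}" "card B < k"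
    and f: "\<And>x y. x \<in> PiE {1..n} X \<Longrightarrow> y \<in> PiE {1..n} X \<Longrightarrow> (\<And>i. i \<in> B \<Longrightarrow> x i = y i) \<Longrightarrow> f x = f y"
  shows "fs_integral (mu_meas k n x x0) f = 0"
proof -
  have finB: "finite B" using finite_subset[OF B(1)] by simp
  let ?c = "\<lambda>j. (-1) ^ (k - j) * real ((n - j - 1) choose (n - k))"
  let ?N = "\<lambda>j E. real (if card E \<le> j then (n - card B) choose (j - card E) else 0)"
  have "(\<Sum>F | F \<subseteq> {1..n} \<and> card F = j. f (splice n F x x0))
      = (\<Sum>E\<in>Pow B. ?N j E * f (splice n E x x0))" for j
  proof -
    have "(\<Sum>F | F \<subseteq> {1..n} \<and> card F = j. f (splice n F x x0))
        = (\<Sum>E\<in>Pow B. \<Sum>F | F \<in> {F. F \<subseteq> {1..n} \<and> card F = j} \<and> F \<inter> B = E. f (splice n F x x0))"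
      using finB by (intro sum.group[symmetric]) (auto intro: rev_finite_subset[of "Pow {1..n}"])
    also have "\<dots> = (\<Sum>E\<in>Pow B. \<Sum>F | F \<subseteq> {1..n} \<and> card F = j \<and> F \<inter> B = E. f (splice n E x x0))"
    proof (intro sum.cong refl)
      fix E F assume "E \<in> Pow B" "F \<in> {F. F \<subseteq> {1..n} \<and> card F = j \<and> F \<inter> B = E}"
      then show "f (splice n F x x0) = f (splice n E x x0)"
        using assms(2,3) B(1) by (intro f splice_PiE) (auto simp: splice_apply)
    qed auto
    also have "\<dots> = (\<Sum>E\<in>Pow B. ?N j E * f (splice n E x x0))"
      using card_subsets_with_trace[OF B(1)] by (intro sum.cong refl) simp
    finally show ?thesis .
  qed
  then have "fs_integral (mu_meas k n x x0) f
      = f x + (\<Sum>j<k. \<Sum>E\<in>Pow B. ?c j * ?N j E * f (splice n E x x0))"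
    by (simp add: fs_integral_mu_meas sum_distrib_left mult.assoc)
  also have "\<dots> = f x + (\<Sum>E\<in>Pow B. (\<Sum>j<k. ?c j * ?N j E) * f (splice n E x x0))"
    by (subst sum.swap) (simp only: sum_distrib_right)
  also have "\<dots> = f x + (\<Sum>E\<in>Pow B. if E = B then - f (splice n E x x0) else 0)"
  proof -
    have "(\<Sum>j<k. ?c j * ?N j E) * f (splice n E x x0) = (if E = B then - f (splice n E x x0) else 0)"
      if "E \<in> Pow B" for E
    proof -
      have "card E \<le> card B" "card E = card B \<longleftrightarrow> E = B"
        using that finB card_subset_eq[of B E] by (auto intro: card_mono)
      then show ?thesis using mu_meas_coefficient[OF B(2) assms(1), of "card E"] by simp
    qed
    then show ?thesis by simp
  qed
  also have "\<dots> = f x - f (splice n B x x0)"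
    using finB by simp
  also have "f (splice n B x x0) = f x"
    using assms(2,3) B(1) by (intro f splice_PiE) (auto simp: splice_apply)
  finally show ?thesis by simp
qed

lemma keys_mu_meas:
  assumes "x \<in> PiE {1..n} X" "x0 \<in> PiE {1..n} X"
  shows "Poly_Mapping.keys (mu_meas k n x x0) \<subseteq> PiE {1..n} X"
proof -
  have "Poly_Mapping.keys (Poly_Mapping.single (splice n F x x0) c) \<subseteq> PiE {1..n} X"
    if "F \<subseteq> {1..n}" for F and c :: real
    using splice_PiE[OF that assms] by simp
  then have "Poly_Mapping.keys (\<Sum>j<k. \<Sum>F | F \<subseteq> {1..n} \<and> card F = j.
      Poly_Mapping.single (splice n F x x0) ((-1) ^ (k - j) * real ((n - j - 1) choose (n - k))))
      \<subseteq> PiE {1..n} X"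
    by (intro order_trans[OF keys_sum] UN_least) blast
  then show ?thesis
    unfolding mu_meas_def using assms by (intro order_trans[OF keys_add]) auto
qed

text \<open>Lets the inequality of \<open>PDI\<close> be applied to such mixtures, which is where
  positive definiteness of \<open>kernel_of\<close> comes from.\<close>

lemma mu_meas_mixture_mem:
  assumes "k \<le> n" "finite A" "A \<subseteq> PiE {1..n} X" "x0 \<in> PiE {1..n} X"
  shows "(\<Sum>x\<in>A. fs_scale (c x) (mu_meas k n x x0)) \<in> M_space k n X"
proof (rule M_spaceI)
  have "Poly_Mapping.keys (fs_scale (c x) (mu_meas k n x x0)) \<subseteq> PiE {1..n} X" if "x \<in> A" for x
    using that assms(3,4) by (intro order_trans[OF keys_fs_scale] keys_mu_meas) auto
  then show "Poly_Mapping.keys (\<Sum>x\<in>A. fs_scale (c x) (mu_meas k n x x0)) \<subseteq> PiE {1..n} X"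
    by (intro order_trans[OF keys_sum] UN_least)
next
  fix B and f :: "(nat \<Rightarrow> 'a) \<Rightarrow> real"
  assume B: "B \<subseteq> {1..n}" "card B < k"
    and f: "\<And>x y. x \<in> PiE {1..n} X \<Longrightarrow> y \<in> PiE {1..n} X \<Longrightarrow> (\<And>i. i \<in> B \<Longrightarrow> x i = y i) \<Longrightarrow> f x = f y"
  have "fs_integral (mu_meas k n x x0) f = 0" if "x \<in> A" for x
    using that assms(3) by (intro fs_integral_mu_meas_eq_0[OF assms(1) _ assms(4) B f]) auto
  then show "fs_integral (\<Sum>x\<in>A. fs_scale (c x) (mu_meas k n x x0)) f = 0"
    by (simp add: fs_integral_sum_measure fs_integral_scale_measure)
qed

text \<open>
  Averaging \<open>mu_meas\<close> over \<open>\<mu>\<close> returns \<open>\<mu>\<close>, because all other terms are marginals of \<open>\<mu>\<close> on fewer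
  than \<open>k\<close> coordinates.
\<close>

lemma M_space_integral_mu_meas:
  assumes "\<mu> \<in> M_space k n X" "x0 \<in> PiE {1..n} X"
  shows "fs_integral \<mu> (\<lambda>x. fs_integral (mu_meas k n x x0) f) = fs_integral \<mu> f"
proof -
  have "fs_integral \<mu> (\<lambda>x. f (splice n F x x0)) = 0" if "F \<subseteq> {1..n}" "card F < k" for F
    using that by (intro M_space_integral_eq_0[OF assms(1)]) (auto intro!: arg_cong[of _ _ f] simp: splice_apply fun_eq_iff)
  then show ?thesis
    by (simp add: fs_integral_mu_meas fs_integral_add fs_integral_sum fs_integral_scale)
qed

section \<open>Symmetry, positivity and norms of the kernel\<close>

lemma n_symmetric_commute:
  assumes "n_symmetric n X I" "x \<in> PiE {1..n} X" "y \<in> PiE {1..n} X"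
  shows "I x y = I y x"
proof -
  \<comment> \<open>The multi-index with all entries 2 exchanges the two points.\<close>
  have "(\<lambda>i\<in>{1..n}. 2) \<in> multi_indices n" by auto
  then have "I x y = I (pick {1..n} (\<lambda>i\<in>{1..n}. 2) x y) (pick {1..n} (flip n (\<lambda>i\<in>{1..n}. 2)) x y)"
    using assms unfolding n_symmetric_def by blast
  also have "pick {1..n} (\<lambda>i\<in>{1..n}. 2) x y = y"
    using assms(3) by (auto simp: pick_def fun_eq_iff PiE_iff extensional_def)
  also have "pick {1..n} (flip n (\<lambda>i\<in>{1..n}. 2)) x y = x"
    using assms(2) by (auto simp: pick_def flip_def fun_eq_iff PiE_iff extensional_def)
  finally show ?thesis .
qed

lemma kernel_of_commute:
  assumes "n_symmetric n X I" "x \<in> PiE {1..n} X" "y \<in> PiE {1..n} X" "x0 \<in> PiE {1..n} X"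
  shows "kernel_of k n I x0 x y = kernel_of k n I x0 y x"
  unfolding kernel_of_def
  using keys_mu_meas[OF assms(2,4), of k] keys_mu_meas[OF assms(3,4), of k] n_symmetric_commute[OF assms(1)]
  by (subst fs_integral_swap) (intro fs_integral_cong, metis (no_types, lifting) subsetD)

lemma kernel_of_psd:
  assumes "k \<le> n" "PDI k n X I" "x0 \<in> PiE {1..n} X" "finite A" "A \<subseteq> PiE {1..n} X"
  shows "0 \<le> (\<Sum>x\<in>A. \<Sum>y\<in>A. c x * c y * kernel_of k n I x0 x y)"
proof -
  let ?\<nu> = "\<Sum>x\<in>A. fs_scale (c x) (mu_meas k n x x0)"
  have "0 \<le> fs_integral ?\<nu> (\<lambda>u. fs_integral ?\<nu> (\<lambda>v. (-1) ^ k * I u v))"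
    using assms mu_meas_mixture_mem[OF assms(1,4,5,3), of c] by (simp add: PDI_def)
  also have "\<dots> = (\<Sum>x\<in>A. \<Sum>y\<in>A. c x * c y * kernel_of k n I x0 x y)"
    by (simp add: fs_integral_sum_measure fs_integral_scale_measure kernel_of_def fs_integral_sum
        fs_integral_scale sum_distrib_left mult_ac)
       (subst sum.swap, simp add: mult_ac)
  finally show ?thesis .
qed

text \<open>Averaging is applied in both variables. The right side no longer contains
  \<open>x0\<close>, which is why constants independent of the base point can exist.\<close>

lemma rkhs_norm_M_space:
  assumes "k \<le> n" "PDI k n X I" "x0 \<in> PiE {1..n} X" "\<mu> \<in> M_space k n X"
  shows "(rkhs_norm (PiE {1..n} X) (kernel_of k n I x0)
      (kernel_embedding (PiE {1..n} X) (kernel_of k n I x0) \<mu>))\<^sup>2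
    = (-1) ^ k * fs_integral \<mu> (\<lambda>u. fs_integral \<mu> (\<lambda>v. I u v))"
proof -
  have "n_symmetric n X I" using assms(2) by (simp add: PDI_def)
  then have "(rkhs_norm (PiE {1..n} X) (kernel_of k n I x0)
      (kernel_embedding (PiE {1..n} X) (kernel_of k n I x0) \<mu>))\<^sup>2
    = fs_integral \<mu> (\<lambda>x. fs_integral \<mu> (\<lambda>y. kernel_of k n I x0 x y))"
    using assms by (intro rkhs_norm_kernel_embedding kernel_of_commute[where X = X] kernel_of_psd)
      (auto simp: M_space_def)
  also have "\<dots> = fs_integral \<mu> (\<lambda>x. fs_integral (mu_meas k n x x0)
      (\<lambda>u. fs_integral \<mu> (\<lambda>y. fs_integral (mu_meas k n y x0) (\<lambda>v. (-1) ^ k * I u v))))"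
    unfolding kernel_of_def by (subst fs_integral_swap) simp
  also have "\<dots> = fs_integral \<mu> (\<lambda>u. fs_integral \<mu> (\<lambda>v. (-1) ^ k * I u v))"
    by (simp add: M_space_integral_mu_meas[OF assms(4,3)])
  finally show ?thesis by (simp add: fs_integral_scale)
qed


section \<open>Multi-indices\<close>

definition flip_on :: "nat \<Rightarrow> nat set \<Rightarrow> (nat \<Rightarrow> nat) \<Rightarrow> nat \<Rightarrow> nat" where
  "flip_on j D \<alpha> = (\<lambda>i\<in>{1..j}. if i \<in> D then 3 - \<alpha> i else \<alpha> i)"

text \<open>For \<open>D \<subseteq> {1..j}\<close>, the weight under
  \<open>\<eta> \<times> \<eta>\<close> of all pairs of multi-indices that differ exactly on
  \<open>D\<close>; for \<open>D = {1..j}\<close> it is the sum in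
  \<open>reversible\<close>.\<close>

definition autocorrelation :: "nat \<Rightarrow> (nat \<Rightarrow> nat) fs_measure \<Rightarrow> nat set \<Rightarrow> real" where
  "autocorrelation j \<eta> D =
    (\<Sum>\<alpha>\<in>multi_indices j. Poly_Mapping.lookup \<eta> \<alpha> * Poly_Mapping.lookup \<eta> (flip_on j D \<alpha>))"

lemma multi_index_cases:
  assumes "\<alpha> \<in> multi_indices j" "i \<in> {1..j}"
  shows "\<alpha> i = 1 \<or> \<alpha> i = 2"
proof -
  have "\<alpha> i \<in> {1, 2}" using assms by (rule PiE_mem)
  then show ?thesis by simp
qed

lemma flip_on_mem:
  assumes "\<alpha> \<in> multi_indices j"
  shows "flip_on j D \<alpha> \<in> multi_indices j"
proof (rule PiE_I)
  show "flip_on j D \<alpha> i \<in> {1, 2}" if "i \<in> {1..j}" for i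
    using multi_index_cases[OF assms that] that by (auto simp: flip_on_def)
qed (auto simp: flip_on_def)

lemma bij_betw_flip_on:
  assumes \<alpha>: "\<alpha> \<in> multi_indices j"
  shows "bij_betw (\<lambda>D. flip_on j D \<alpha>) (Pow {1..j}) (multi_indices j)"
proof (rule bij_betw_byWitness[where f' = "\<lambda>\<beta>. {i\<in>{1..j}. \<alpha> i \<noteq> \<beta> i}"])
  note cases = multi_index_cases[OF \<alpha>]
  show "\<forall>D\<in>Pow {1..j}. {i \<in> {1..j}. \<alpha> i \<noteq> flip_on j D \<alpha> i} = D"
  proof (intro ballI set_eqI)
    fix D i assume D: "D \<in> Pow {1..j}"
    show "i \<in> {i \<in> {1..j}. \<alpha> i \<noteq> flip_on j D \<alpha> i} \<longleftrightarrow> i \<in> D"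
    proof (cases "i \<in> {1..j}")
      case True
      then show ?thesis using cases[OF True] by (auto simp: flip_on_def)
    qed (use D in auto)
  qed
  show "\<forall>\<beta>\<in>multi_indices j. flip_on j {i \<in> {1..j}. \<alpha> i \<noteq> \<beta> i} \<alpha> = \<beta>"
  proof (intro ballI ext)
    fix \<beta> i assume \<beta>: "\<beta> \<in> multi_indices j"
    show "flip_on j {i \<in> {1..j}. \<alpha> i \<noteq> \<beta> i} \<alpha> i = \<beta> i"
    proof (cases "i \<in> {1..j}")
      case True
      then show ?thesis
        using cases[OF True] multi_index_cases[OF \<beta> True] by (auto simp: flip_on_def)
    next
      case False
      then show ?thesis using PiE_arb[OF \<beta> False] by (simp add: flip_on_def del: atLeastAtMost_iff)
    qed
  qed
  show "(\<lambda>D. flip_on j D \<alpha>) ` Pow {1..j} \<subseteq> multi_indices j"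
    using flip_on_mem[OF \<alpha>] by blast
qed auto

lemma permutation_between_subsets:
  assumes "finite S" "D \<subseteq> S" "E \<subseteq> S" "card D = card E"
  obtains p where "p permutes S" "p ` D = E"
proof -
  have fin: "finite D" "finite E" using assms finite_subset by blast+
  obtain f where f: "bij_betw f D E"
    using finite_same_card_bij[OF fin assms(4)] by blast
  have "card (S - D) = card (S - E)" using assms fin by (simp add: card_Diff_subset)
  then obtain g where g: "bij_betw g (S - D) (S - E)"
    using finite_same_card_bij[of "S - D" "S - E"] assms(1) by blast
  define p where "p = (\<lambda>i. if i \<in> D then f i else if i \<in> S then g i else i)"
  have p: "bij_betw p D E" "bij_betw p (S - D) (S - E)"
    using f g bij_betw_cong[of D p f E] bij_betw_cong[of "S - D" p g "S - E"] by (simp_all add: p_def)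
  then have "bij_betw p (D \<union> (S - D)) (E \<union> (S - E))"
    by (intro bij_betw_combine) auto
  moreover have "D \<union> (S - D) = S" "E \<union> (S - E) = S" using assms by auto
  ultimately have "p permutes S"
    using assms(2) by (intro bij_imp_permutes) (auto simp: p_def)
  then show ?thesis using that p(1) by (auto simp: bij_betw_def)
qed

lemma bij_betw_multi_indices_permute:
  assumes p: "p permutes {1..j}"
  shows "bij_betw (\<lambda>\<alpha>. \<alpha> \<circ> p) (multi_indices j) (multi_indices j)"
proof (rule bij_betw_byWitness[where f' = "\<lambda>\<alpha>. \<alpha> \<circ> inv p"])
  have comp: "\<alpha> \<circ> q \<in> multi_indices j" if q: "q permutes {1..j}" and \<alpha>: "\<alpha> \<in> multi_indices j" for q \<alpha>
  proof (rule PiE_I)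
    fix i assume "i \<in> {1..j}"
    then have "q i \<in> {1..j}" using permutes_in_image[OF q] by simp
    then show "(\<alpha> \<circ> q) i \<in> {1, 2}" unfolding comp_apply by (rule PiE_mem[OF \<alpha>])
  next
    fix i assume "i \<notin> {1..j}"
    then show "(\<alpha> \<circ> q) i = undefined"
      using permutes_not_in[OF q] PiE_arb[OF \<alpha>] by simp
  qed
  show "(\<lambda>\<alpha>. \<alpha> \<circ> p) ` multi_indices j \<subseteq> multi_indices j"
    "(\<lambda>\<alpha>. \<alpha> \<circ> inv p) ` multi_indices j \<subseteq> multi_indices j"
    using comp p permutes_inv[OF p] by blast+
qed (simp_all add: comp_assoc permutes_inv_o[OF p])

text \<open>Reindex by \<open>\<alpha> \<mapsto> \<alpha> \<circ> p\<close>: flipping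
  \<open>\<alpha> \<circ> p\<close> on \<open>D\<close> is the same as flipping
  \<open>\<alpha>\<close> on the image of \<open>D\<close> and then composing with
  \<open>p\<close>.\<close>

lemma autocorrelation_image:
  assumes PI: "permutation_invariant j \<eta>" and p: "p permutes {1..j}"
  shows "autocorrelation j \<eta> (p ` D) = autocorrelation j \<eta> D"
proof -
  have flip: "flip_on j D (\<alpha> \<circ> p) = flip_on j (p ` D) \<alpha> \<circ> p" if "\<alpha> \<in> multi_indices j" for \<alpha>
  proof
    fix i
    have "p i \<in> {1..j} \<longleftrightarrow> i \<in> {1..j}" "p i \<in> p ` D \<longleftrightarrow> i \<in> D"
      using permutes_in_image[OF p] inj_image_mem_iff[OF permutes_inj[OF p]] by blast+
    then show "flip_on j D (\<alpha> \<circ> p) i = (flip_on j (p ` D) \<alpha> \<circ> p) i"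
      by (simp add: flip_on_def del: atLeastAtMost_iff)
  qed
  have "autocorrelation j \<eta> D = (\<Sum>\<alpha>\<in>multi_indices j.
      Poly_Mapping.lookup \<eta> (\<alpha> \<circ> p) * Poly_Mapping.lookup \<eta> (flip_on j D (\<alpha> \<circ> p)))"
    unfolding autocorrelation_def
    by (rule sum.reindex_bij_betw[OF bij_betw_multi_indices_permute[OF p], symmetric])
  also have "\<dots> = autocorrelation j \<eta> (p ` D)"
    unfolding autocorrelation_def
  proof (intro sum.cong refl)
    fix \<alpha> assume \<alpha>: "\<alpha> \<in> multi_indices j"
    have "flip_on j (p ` D) \<alpha> \<in> multi_indices j"
      by (rule flip_on_mem[OF \<alpha>])
    then show "Poly_Mapping.lookup \<eta> (\<alpha> \<circ> p) * Poly_Mapping.lookup \<eta> (flip_on j D (\<alpha> \<circ> p))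
        = Poly_Mapping.lookup \<eta> \<alpha> * Poly_Mapping.lookup \<eta> (flip_on j (p ` D) \<alpha>)"
      using PI p \<alpha> by (simp add: flip permutation_invariant_def)
  qed
  finally show ?thesis by simp
qed

lemma autocorrelation_card:
  assumes "permutation_invariant j \<eta>" "D \<subseteq> {1..j}"
  shows "autocorrelation j \<eta> D = autocorrelation j \<eta> {1..card D}"
proof -
  have "card D \<le> j" using card_mono[OF _ assms(2)] by simp
  then obtain p where "p permutes {1..j}" "p ` D = {1..card D}"
    using permutation_between_subsets[of "{1..j}" D "{1..card D}"] assms(2) by auto
  then show ?thesis using autocorrelation_image[OF assms(1), of p D] by simp
qed

lemma autocorrelation_reversible:
  "reversible j \<eta> \<longleftrightarrow> autocorrelation j \<eta> {1..j} \<noteq> 0"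
proof -
  have "flip_on j {1..j} \<alpha> = flip j \<alpha>" for \<alpha>
    by (auto simp: flip_on_def flip_def fun_eq_iff)
  then show ?thesis by (simp add: reversible_def autocorrelation_def)
qed

lemma bij_betw_position:
  fixes F :: "nat set"
  assumes "finite F"
  shows "bij_betw (\<lambda>i. card {l\<in>F. l \<le> i}) F {1..card F}"
proof -
  let ?pos = "\<lambda>i. card {l\<in>F. l \<le> i}"
  have less: "?pos i < ?pos i'" if "i \<in> F" "i' \<in> F" "i < i'" for i i'
  proof (rule psubset_card_mono)
    have "i' \<in> {l\<in>F. l \<le> i'}" "i' \<notin> {l\<in>F. l \<le> i}" using that by simp_all
    moreover have "{l\<in>F. l \<le> i} \<subseteq> {l\<in>F. l \<le> i'}" using that(3) by auto
    ultimately show "{l\<in>F. l \<le> i} \<subset> {l\<in>F. l \<le> i'}" by blast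
  qed (use assms in simp)
  have inj: "inj_on ?pos F"
  proof (rule inj_onI)
    fix i i' assume "i \<in> F" "i' \<in> F" "?pos i = ?pos i'"
    then show "i = i'"
      using less[of i i'] less[of i' i] by (cases i i' rule: linorder_cases) simp_all
  qed
  have "?pos i \<in> {1..card F}" if "i \<in> F" for i
  proof -
    have "{l\<in>F. l \<le> i} \<noteq> {}" using that by auto
    then have "0 < ?pos i" using assms by (simp add: card_gt_0_iff)
    moreover have "?pos i \<le> card F" using assms by (intro card_mono) auto
    ultimately show ?thesis by simp
  qed
  then have "?pos ` F \<subseteq> {1..card F}" by blast
  then have "?pos ` F = {1..card F}"
    using inj by (intro card_subset_eq) (simp_all add: card_image)
  then show ?thesis using inj by (simp add: bij_betw_def)
qed


section \<open>The norms as combinations of kernel values\<close>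

lemma splice_pick_PiE:
  assumes "F \<subseteq> {1..n}" "x1 \<in> PiE {1..n} X" "x2 \<in> PiE {1..n} X" "x3 \<in> PiE {1..n} X"
  shows "splice n F (pick F \<gamma> x1 x2) x3 \<in> PiE {1..n} X"
  using assms by (intro splice_mem) (auto simp: pick_def PiE_iff)

lemma fs_integral_eta_product:
  "fs_integral (product_measure n F (eta_at F \<eta> x1 x2)
      (Poly_Mapping.single (restrict x3 ({1..n} - F)) 1)) f
    = fs_integral \<eta> (\<lambda>\<alpha>. f (splice n F (pick F (spread F \<alpha>) x1 x2) x3))"
proof -
  have "splice n F u (restrict x3 ({1..n} - F)) = splice n F u x3" for u :: "nat \<Rightarrow> 'a"
    by (auto simp: splice_apply fun_eq_iff)
  then have "fs_integral (product_measure n F \<mu> (Poly_Mapping.single (restrict x3 ({1..n} - F)) 1)) f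
      = fs_integral \<mu> (\<lambda>u. f (splice n F u x3))" for \<mu>
    by (simp add: product_measure_def fs_integral_sum_measure) (simp add: fs_integral_def)
  then show ?thesis by (simp add: eta_at_def fs_integral_pushforward)
qed

text \<open>A function of the coordinates in \<open>B\<close> pulls back along the selection to a
  function of the entries of \<open>\<alpha>\<close> at the positions of
  \<open>F \<inter> B\<close>, again fewer than \<open>k\<close>. So the vanishing integrals are
  inherited from \<open>\<eta>\<close>.\<close>

lemma eta_product_M_space:
  assumes F: "F \<subseteq> {1..n}"
    and x: "x1 \<in> PiE {1..n} X" "x2 \<in> PiE {1..n} X" "x3 \<in> PiE {1..n} X"
    and \<eta>: "\<eta> \<in> M_space k (card F) (\<lambda>_. {1, 2})"
  shows "product_measure n F (eta_at F \<eta> x1 x2)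
      (Poly_Mapping.single (restrict x3 ({1..n} - F)) 1) \<in> M_space k n X"
proof (rule M_spaceI)
  have eq: "splice n F u (restrict x3 ({1..n} - F)) = splice n F u x3" for u
    by (auto simp: splice_apply fun_eq_iff)
  have "Poly_Mapping.keys (eta_at F \<eta> x1 x2)
      \<subseteq> (\<Union>\<alpha>\<in>Poly_Mapping.keys \<eta>. {pick F (spread F \<alpha>) x1 x2})"
    unfolding eta_at_def pushforward_def by (rule order_trans[OF keys_sum]) auto
  then have "splice n F u x3 \<in> PiE {1..n} X" if "u \<in> Poly_Mapping.keys (eta_at F \<eta> x1 x2)" for u
    using that splice_pick_PiE[OF F x] by blast
  then show "Poly_Mapping.keys (product_measure n F (eta_at F \<eta> x1 x2)
      (Poly_Mapping.single (restrict x3 ({1..n} - F)) 1)) \<subseteq> PiE {1..n} X"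
    unfolding product_measure_def
  proof (intro order_trans[OF keys_sum] UN_least)
    fix u v
    assume uv: "u \<in> Poly_Mapping.keys (eta_at F \<eta> x1 x2)"
      "v \<in> Poly_Mapping.keys (Poly_Mapping.single (restrict x3 ({1..n} - F)) (1::real))"
    have "v = restrict x3 ({1..n} - F)" using uv(2) by simp
    then have "splice n F u v = splice n F u x3" using eq[of u] by simp
    then have "splice n F u v \<in> PiE {1..n} X"
      using \<open>\<And>u. u \<in> _ \<Longrightarrow> splice n F u x3 \<in> _\<close> uv(1) by simp
    then show "Poly_Mapping.keys (Poly_Mapping.single (splice n F u v)
        (Poly_Mapping.lookup (eta_at F \<eta> x1 x2) u *
         Poly_Mapping.lookup (Poly_Mapping.single (restrict x3 ({1..n} - F)) 1) v))
        \<subseteq> PiE {1..n} X"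
      by simp
  qed
next
  fix B and f :: "(nat \<Rightarrow> 'a) \<Rightarrow> real"
  assume B: "B \<subseteq> {1..n}" "card B < k"
    and f: "\<And>x y. x \<in> PiE {1..n} X \<Longrightarrow> y \<in> PiE {1..n} X \<Longrightarrow> (\<And>i. i \<in> B \<Longrightarrow> x i = y i) \<Longrightarrow> f x = f y"
  let ?pos = "\<lambda>i. card {l\<in>F. l \<le> i}"
  let ?P = "\<lambda>\<alpha>. splice n F (pick F (spread F \<alpha>) x1 x2) x3"
  have fin: "finite F" "finite B" using finite_subset[OF F] finite_subset[OF B(1)] by simp_all
  have "fs_integral \<eta> (\<lambda>\<alpha>. f (?P \<alpha>)) = 0"
  proof (rule M_space_integral_eq_0[OF \<eta>])
    show "?pos ` (F \<inter> B) \<subseteq> {1..card F}"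
      using bij_betw_imp_surj_on[OF bij_betw_position[OF fin(1)]] by blast
    have "card (?pos ` (F \<inter> B)) \<le> card (F \<inter> B)" using fin by (intro card_image_le) simp
    also have "\<dots> \<le> card B" using fin by (intro card_mono) auto
    finally show "card (?pos ` (F \<inter> B)) < k" using B(2) by simp
    fix \<alpha> \<beta> :: "nat \<Rightarrow> nat"
    assume "\<And>i. i \<in> ?pos ` (F \<inter> B) \<Longrightarrow> \<alpha> i = \<beta> i"
    then have "\<alpha> (?pos i) = \<beta> (?pos i)" if "i \<in> F" "i \<in> B" for i using that by blast
    then show "f (?P \<alpha>) = f (?P \<beta>)"
      by (intro f splice_pick_PiE F x) (auto simp: splice_apply pick_def spread_def)
  qed
  then show "fs_integral (product_measure n F (eta_at F \<eta> x1 x2)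
      (Poly_Mapping.single (restrict x3 ({1..n} - F)) 1)) f = 0"
    by (simp only: fs_integral_eta_product)
qed

text \<open>
  By completeness the coordinates on which the two selections agree may be replaced by those of
  \<open>x3\<close>; on the others, symmetry turns the selections into \<open>x1\<close> and \<open>x2\<close>.
\<close>

lemma kernel_at_selections:
  assumes I: "complete_n_symmetric n X I" and F: "F \<subseteq> {1..n}"
    and x: "x1 \<in> PiE {1..n} X" "x2 \<in> PiE {1..n} X" "x3 \<in> PiE {1..n} X"
    and \<gamma>: "\<And>i. i \<in> F \<Longrightarrow> \<gamma> i = 1 \<or> \<gamma> i = 2" and \<delta>: "\<And>i. i \<in> F \<Longrightarrow> \<delta> i = 1 \<or> \<delta> i = 2"
  defines "D \<equiv> {i\<in>F. \<gamma> i \<noteq> \<delta> i}"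
  shows "I (splice n F (pick F \<gamma> x1 x2) x3) (splice n F (pick F \<delta> x1 x2) x3)
    = I (splice n D x1 x3) (splice n D x2 x3)"
proof -
  have D: "D \<subseteq> {1..n}" using F by (auto simp: D_def)
  let ?u = "splice n F (pick F \<gamma> x1 x2) x3" and ?v = "splice n F (pick F \<delta> x1 x2) x3"
  let ?y1 = "splice n D x1 x3" and ?y2 = "splice n D x2 x3"
  \<comment> \<open>Off \<open>D\<close> both \<open>?y1\<close> and \<open>?y2\<close> carry the
    coordinates of \<open>x3\<close>, so the entry 1 there is an arbitrary choice.\<close>
  let ?\<alpha> = "\<lambda>i\<in>{1..n}. if i \<in> D then \<gamma> i else 1"
  have u: "?u \<in> PiE {1..n} X" and v: "?v \<in> PiE {1..n} X" using splice_pick_PiE[OF F x] by blast+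
  have y: "?y1 \<in> PiE {1..n} X" "?y2 \<in> PiE {1..n} X" using splice_PiE[OF D] x by blast+
  \<comment> \<open>Off \<open>D\<close> both points carry the coordinates of \<open>?u\<close>, the
    shape in which completeness applies.\<close>
  have "splice n D ?u ?u = ?u" "splice n D ?v ?u = ?v"
    using F by (auto simp: splice_apply fun_eq_iff D_def pick_def)
  then have "I ?u ?v = I (splice n D ?u ?u) (splice n D ?v ?u)" by simp
  also have "\<dots> = I (splice n D ?u x3) (splice n D ?v x3)"
    using I D u v x(3) unfolding complete_n_symmetric_def by blast
  also have "splice n D ?u x3 = pick {1..n} ?\<alpha> ?y1 ?y2"
    using F by (auto simp: splice_apply fun_eq_iff D_def pick_def)
  also have "splice n D ?v x3 = pick {1..n} (flip n ?\<alpha>) ?y1 ?y2"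
  proof
    fix i
    show "splice n D ?v x3 i = pick {1..n} (flip n ?\<alpha>) ?y1 ?y2 i"
      using F \<gamma>[of i] \<delta>[of i] by (auto simp: splice_apply D_def pick_def flip_def)
  qed
  also have "I (pick {1..n} ?\<alpha> ?y1 ?y2) (pick {1..n} (flip n ?\<alpha>) ?y1 ?y2) = I ?y1 ?y2"
  proof -
    have "?\<alpha> \<in> multi_indices n" using \<gamma> by (auto simp: D_def)
    moreover have "n_symmetric n X I" using I by (simp add: complete_n_symmetric_def)
    ultimately have "I ?y1 ?y2 = I (pick {1..n} ?\<alpha> ?y1 ?y2) (pick {1..n} (flip n ?\<alpha>) ?y1 ?y2)"
      using y unfolding n_symmetric_def by blast
    then show ?thesis by (rule sym)
  qed
  finally show ?thesis .
qed

text \<open>For fixed \<open>\<alpha>\<close>, the index \<open>\<beta>\<close> is replaced by the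
  set \<open>D\<close> where it differs from \<open>\<alpha>\<close>. The kernel value depends only
  on \<open>D\<close>, so summing over \<open>\<alpha>\<close> leaves an autocorrelation, which
  permutation invariance reduces to a function of \<open>card D\<close>.\<close>

lemma double_integral_eta_product:
  assumes I: "complete_n_symmetric n X I" and F: "F \<subseteq> {1..n}"
    and x: "x1 \<in> PiE {1..n} X" "x2 \<in> PiE {1..n} X" "x3 \<in> PiE {1..n} X"
    and keys: "Poly_Mapping.keys \<eta> \<subseteq> multi_indices (card F)"
    and PI: "permutation_invariant (card F) \<eta>"
  defines "\<mu> \<equiv> product_measure n F (eta_at F \<eta> x1 x2)
      (Poly_Mapping.single (restrict x3 ({1..n} - F)) 1)"
  shows "fs_integral \<mu> (\<lambda>u. fs_integral \<mu> (\<lambda>v. I u v))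
    = (\<Sum>D\<in>Pow F. autocorrelation (card F) \<eta> {1..card D} * I (splice n D x1 x3) (splice n D x2 x3))"
proof -
  let ?j = "card F"
  let ?pos = "\<lambda>i. card {l\<in>F. l \<le> i}"
  let ?P = "\<lambda>\<alpha>. splice n F (pick F (spread F \<alpha>) x1 x2) x3"
  let ?J = "\<lambda>D. I (splice n D x1 x3) (splice n D x2 x3)"
  let ?l = "Poly_Mapping.lookup \<eta>"
  have finF: "finite F" using finite_subset[OF F] by simp
  have pos: "bij_betw ?pos F {1..?j}" using bij_betw_position[OF finF] .
  have finM: "finite (multi_indices ?j)" by (intro finite_PiE) auto
  have val: "I (?P \<alpha>) (?P (flip_on ?j (?pos ` D) \<alpha>)) = ?J D"
    if \<alpha>: "\<alpha> \<in> multi_indices ?j" and D: "D \<subseteq> F" for \<alpha> D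
  proof -
    let ?\<beta> = "flip_on ?j (?pos ` D) \<alpha>"
    have in_range: "?pos i \<in> {1..?j}" if "i \<in> F" for i
      using bij_betwE[OF pos] that by blast
    have mem: "?pos i \<in> ?pos ` D \<longleftrightarrow> i \<in> D" if "i \<in> F" for i
      using inj_on_image_mem_iff[OF bij_betw_imp_inj_on[OF pos] that D] .
    have spread: "spread F \<alpha> i = \<alpha> (?pos i)"
      "spread F ?\<beta> i = (if i \<in> D then 3 - \<alpha> (?pos i) else \<alpha> (?pos i))" if "i \<in> F" for i
      using that in_range[OF that] mem[OF that] by (simp_all add: spread_def flip_on_def del: atLeastAtMost_iff)
    have cases: "\<alpha> (?pos i) = 1 \<or> \<alpha> (?pos i) = 2" if "i \<in> F" for i
      using multi_index_cases[OF \<alpha> in_range[OF that]] .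
    have "{i\<in>F. spread F \<alpha> i \<noteq> spread F ?\<beta> i} = D"
    proof (intro set_eqI iffI)
      fix i assume "i \<in> {i\<in>F. spread F \<alpha> i \<noteq> spread F ?\<beta> i}"
      then show "i \<in> D" using spread[of i] by (auto split: if_splits)
    next
      fix i assume i: "i \<in> D"
      then have iF: "i \<in> F" using D by blast
      have "3 - \<alpha> (?pos i) \<noteq> \<alpha> (?pos i)" using cases[OF iF] by auto
      then show "i \<in> {i\<in>F. spread F \<alpha> i \<noteq> spread F ?\<beta> i}"
        using i iF spread[OF iF] by simp
    qed
    moreover have "I (?P \<alpha>) (?P ?\<beta>) = ?J {i\<in>F. spread F \<alpha> i \<noteq> spread F ?\<beta> i}"
    proof (rule kernel_at_selections[OF I F x])
      show "spread F \<alpha> i = 1 \<or> spread F \<alpha> i = 2" if "i \<in> F" for i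
        using spread(1)[OF that] cases[OF that] by simp
      show "spread F ?\<beta> i = 1 \<or> spread F ?\<beta> i = 2" if "i \<in> F" for i
        using spread(2)[OF that] cases[OF that] by auto
    qed
    ultimately show ?thesis by simp
  qed
  have "fs_integral \<mu> (\<lambda>u. fs_integral \<mu> (\<lambda>v. I u v))
      = (\<Sum>\<alpha>\<in>multi_indices ?j. (\<Sum>\<beta>\<in>multi_indices ?j. I (?P \<alpha>) (?P \<beta>) * ?l \<beta>) * ?l \<alpha>)"
    unfolding \<mu>_def fs_integral_eta_product fs_integral_superset[OF finM keys] ..
  also have "\<dots> = (\<Sum>\<alpha>\<in>multi_indices ?j. \<Sum>D\<in>Pow F. ?J D * (?l \<alpha> * ?l (flip_on ?j (?pos ` D) \<alpha>)))"
  proof (rule sum.cong[OF refl])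
    fix \<alpha> assume \<alpha>: "\<alpha> \<in> multi_indices ?j"
    have "(\<Sum>\<beta>\<in>multi_indices ?j. I (?P \<alpha>) (?P \<beta>) * ?l \<beta>)
        = (\<Sum>D\<in>Pow {1..?j}. I (?P \<alpha>) (?P (flip_on ?j D \<alpha>)) * ?l (flip_on ?j D \<alpha>))"
      by (rule sum.reindex_bij_betw[OF bij_betw_flip_on[OF \<alpha>], symmetric])
    also have "\<dots> = (\<Sum>D\<in>Pow F. I (?P \<alpha>) (?P (flip_on ?j (?pos ` D) \<alpha>)) * ?l (flip_on ?j (?pos ` D) \<alpha>))"
      by (rule sum.reindex_bij_betw[OF bij_betw_Pow[OF pos], symmetric])
    also have "\<dots> = (\<Sum>D\<in>Pow F. ?J D * ?l (flip_on ?j (?pos ` D) \<alpha>))"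
      using val[OF \<alpha>] by (intro sum.cong refl) simp
    finally show "(\<Sum>\<beta>\<in>multi_indices ?j. I (?P \<alpha>) (?P \<beta>) * ?l \<beta>) * ?l \<alpha>
        = (\<Sum>D\<in>Pow F. ?J D * (?l \<alpha> * ?l (flip_on ?j (?pos ` D) \<alpha>)))"
      by (simp add: sum_distrib_left mult_ac)
  qed
  also have "\<dots> = (\<Sum>D\<in>Pow F. ?J D * autocorrelation ?j \<eta> (?pos ` D))"
    unfolding autocorrelation_def sum_distrib_left by (rule sum.swap)
  also have "\<dots> = (\<Sum>D\<in>Pow F. autocorrelation ?j \<eta> {1..card D} * ?J D)"
  proof (rule sum.cong[OF refl])
    fix D assume D: "D \<in> Pow F"
    have inj: "inj_on ?pos D" using bij_betw_imp_inj_on[OF pos] D by (auto intro: inj_on_subset)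
    have "?pos ` D \<subseteq> {1..?j}" using bij_betw_imp_surj_on[OF pos] D by blast
    then have "autocorrelation ?j \<eta> (?pos ` D) = autocorrelation ?j \<eta> {1..card (?pos ` D)}"
      by (rule autocorrelation_card[OF PI])
    then show "?J D * autocorrelation ?j \<eta> (?pos ` D) = autocorrelation ?j \<eta> {1..card D} * ?J D"
      by (simp add: card_image[OF inj])
  qed
  finally show ?thesis .
qed

section \<open>The triangular system between norms and kernel sums\<close>

lemma triangular_solve:
  fixes a :: "nat \<Rightarrow> nat \<Rightarrow> real"
  assumes diag: "\<And>j. j \<in> {k..N} \<Longrightarrow> a j j \<noteq> 0"
  shows "n \<in> {k..N} \<Longrightarrow> \<exists>b. \<forall>S. S n = (\<Sum>j=k..N. b j * (\<Sum>m=k..j. a j m * S m))"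
proof (induction n rule: less_induct)
  case (less n)
  let ?T = "\<lambda>S j. \<Sum>m=k..j. a j m * S m"
  have "\<forall>m\<in>{k..<n}. \<exists>b. \<forall>S. S m = (\<Sum>j=k..N. b j * ?T S j)"
    using less by auto
  then obtain c where c: "\<And>m S. m \<in> {k..<n} \<Longrightarrow> S m = (\<Sum>j=k..N. c m j * ?T S j)"
    by metis
  \<comment> \<open>Row \<open>n\<close> gives \<open>a n n * S n\<close> as \<open>?T S n\<close>
    minus the terms \<open>a n m * S m\<close> with \<open>m < n\<close>. Inserting the earlier
    solutions \<open>c m\<close> and collecting the coefficient of \<open>?T S j\<close> yields
    \<open>b j\<close>.\<close>
  define b where "b = (\<lambda>j. ((if j = n then 1 else 0) - (\<Sum>m=k..<n. a n m * c m j)) / a n n)"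
  have "S n = (\<Sum>j=k..N. b j * ?T S j)" for S
  proof -
    have "(\<Sum>j=k..N. b j * ?T S j) = (\<Sum>j=k..N. ((if j = n then ?T S j else 0)
        - (\<Sum>m=k..<n. a n m * (c m j * ?T S j))) / a n n)"
      by (intro sum.cong refl) (simp add: b_def sum_distrib_right left_diff_distrib mult.assoc)
    also have "\<dots> = ((\<Sum>j=k..N. if j = n then ?T S j else 0)
        - (\<Sum>j=k..N. \<Sum>m=k..<n. a n m * (c m j * ?T S j))) / a n n"
      by (simp only: sum_divide_distrib[symmetric] sum_subtractf)
    also have "(\<Sum>j=k..N. if j = n then ?T S j else 0) = ?T S n"
      using less.prems by simp
    also have "(\<Sum>j=k..N. \<Sum>m=k..<n. a n m * (c m j * ?T S j)) = (\<Sum>m=k..<n. a n m * S m)"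
      by (subst sum.swap, intro sum.cong refl) (simp add: c[of _ S] flip: sum_distrib_left)
    also have "?T S n = (\<Sum>m=k..<n. a n m * S m) + a n n * S n"
      using less.prems by (simp add: atLeastLessThanSuc_atLeastAtMost[symmetric])
    finally show ?thesis using diag[OF less.prems] by simp
  qed
  then show ?case by blast
qed

text \<open>Exchange the sums: a set \<open>D\<close> of size \<open>m \<le> j\<close> lies in
  \<open>(n - m) choose (j - m)\<close> sets \<open>F\<close> of size \<open>j\<close>. Sizes below
  \<open>k\<close> drop out because \<open>J\<close> vanishes there.\<close>

lemma sum_over_subsets_of_subsets:
  fixes g :: "nat \<Rightarrow> real" and J :: "nat set \<Rightarrow> real"
  assumes J: "\<And>D. D \<subseteq> {1..n} \<Longrightarrow> card D < k \<Longrightarrow> J D = 0" and j: "j \<le> n"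
  shows "(\<Sum>F | F \<subseteq> {1..n} \<and> card F = j. \<Sum>D\<in>Pow F. g (card D) * J D)
    = (\<Sum>m=k..j. g m * real ((n - m) choose (j - m)) * (\<Sum>D | D \<subseteq> {1..n} \<and> card D = m. J D))"
proof -
  let ?P = "Pow {1..n}"
  let ?N = "\<lambda>m. real (if m \<le> j then (n - m) choose (j - m) else 0)"
  have fin: "finite {F. F \<subseteq> {1..n} \<and> card F = j}"
    by (rule finite_subset[of _ ?P]) auto
  have "(\<Sum>F | F \<subseteq> {1..n} \<and> card F = j. \<Sum>D\<in>Pow F. g (card D) * J D)
      = (\<Sum>F | F \<subseteq> {1..n} \<and> card F = j. \<Sum>D\<in>?P. if D \<subseteq> F then g (card D) * J D else 0)"
    by (intro sum.cong refl sum.mono_neutral_cong_left) auto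
  also have "\<dots> = (\<Sum>D\<in>?P. \<Sum>F | F \<subseteq> {1..n} \<and> card F = j. if D \<subseteq> F then g (card D) * J D else 0)"
    by (rule sum.swap)
  also have "\<dots> = (\<Sum>D\<in>?P. g (card D) * ?N (card D) * J D)"
  proof (intro sum.cong refl)
    fix D assume D: "D \<in> ?P"
    have "(\<Sum>F | F \<subseteq> {1..n} \<and> card F = j. if D \<subseteq> F then g (card D) * J D else 0)
        = (\<Sum>F\<in>{F \<in> {F. F \<subseteq> {1..n} \<and> card F = j}. D \<subseteq> F}. g (card D) * J D)"
      using fin by (subst sum.inter_filter) auto
    also have "{F \<in> {F. F \<subseteq> {1..n} \<and> card F = j}. D \<subseteq> F}
        = {F. F \<subseteq> {1..n} \<and> card F = j \<and> F \<inter> D = D}" by auto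
    finally show "(\<Sum>F | F \<subseteq> {1..n} \<and> card F = j. if D \<subseteq> F then g (card D) * J D else 0)
        = g (card D) * ?N (card D) * J D"
      using card_subsets_with_trace[of D n D j] D by simp
  qed
  also have "\<dots> = (\<Sum>m\<in>{..n}. \<Sum>D | D \<in> ?P \<and> card D = m. g (card D) * ?N (card D) * J D)"
  proof (rule sum.group[symmetric])
    show "card ` ?P \<subseteq> {..n}" using card_mono[of "{1..n}"] by fastforce
  qed auto
  also have "\<dots> = (\<Sum>m\<in>{..n}. g m * ?N m * (\<Sum>D | D \<subseteq> {1..n} \<and> card D = m. J D))"
    unfolding sum_distrib_left by (intro sum.cong refl) auto
  also have "\<dots> = (\<Sum>m=k..j. g m * real ((n - m) choose (j - m)) * (\<Sum>D | D \<subseteq> {1..n} \<and> card D = m. J D))"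
  proof (rule sum.mono_neutral_cong_right)
    show "\<forall>m\<in>{..n} - {k..j}. g m * ?N m * (\<Sum>D | D \<subseteq> {1..n} \<and> card D = m. J D) = 0"
    proof
      fix m assume "m \<in> {..n} - {k..j}"
      then consider "m < k" | "j < m" by fastforce
      then show "g m * ?N m * (\<Sum>D | D \<subseteq> {1..n} \<and> card D = m. J D) = 0"
        by cases (simp_all add: J)
    qed
  qed (use j in auto)
  finally show ?thesis .
qed

theorem theorem58:
  fixes n k :: nat
    and X :: "nat \<Rightarrow> 'a set"
    and I :: "(nat \<Rightarrow> 'a) \<Rightarrow> (nat \<Rightarrow> 'a) \<Rightarrow> real"
    and \<eta> :: "nat \<Rightarrow> (nat \<Rightarrow> nat) fs_measure"
    and x3 :: "nat \<Rightarrow> 'a"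
  assumes "k \<le> n"
    and "\<And>i. i \<in> {1..n} \<Longrightarrow> X i \<noteq> {}"
    and "complete_n_symmetric n X I"
    and "PDI k n X I"
    and "\<And>x y. (x, y) \<in> extended_diagonal_pred k n X \<Longrightarrow> I x y = 0"
    and "\<And>j. j \<in> {k..n} \<Longrightarrow> \<eta> j \<in> M_space k j (\<lambda>_. {1, 2})"
    and "\<And>j. j \<in> {k..n} \<Longrightarrow> permutation_invariant j (\<eta> j)"
    and "\<And>j. j \<in> {k..n} \<Longrightarrow> reversible j (\<eta> j)"
    and "x3 \<in> PiE {1..n} X"
  shows "\<exists>b :: nat \<Rightarrow> real.
    \<forall>x1\<in>PiE {1..n} X. \<forall>x2\<in>PiE {1..n} X. \<forall>x0\<in>PiE {1..n} X.
      I x1 x2 =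
        (\<Sum>j=k..n. \<Sum>F | F \<subseteq> {1..n} \<and> card F = j.
           b j * (rkhs_norm (PiE {1..n} X) (kernel_of k n I x0)
                   (kernel_embedding (PiE {1..n} X) (kernel_of k n I x0)
                     (product_measure n F (eta_at F (\<eta> j) x1 x2)
                       (Poly_Mapping.single (restrict x3 ({1..n} - F)) 1))))\<^sup>2)"
proof -
  \<comment> \<open>The matrix of the system. On the diagonal the binomial is 1, so reversibility
    makes the entry nonzero.\<close>
  define a where "a = (\<lambda>j m. (-1) ^ k * autocorrelation j (\<eta> j) {1..m} * real ((n - m) choose (j - m)))"
  have "a j j \<noteq> 0" if "j \<in> {k..n}" for j
    using assms(8)[OF that] by (simp add: a_def autocorrelation_reversible)
  \<comment> \<open>\<open>b\<close> is fixed before \<open>x1\<close>, \<open>x2\<close> and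
    \<open>x0\<close>: it recovers \<open>S n\<close> for every \<open>S\<close> at once.\<close>
  then obtain b where b: "\<And>S. S n = (\<Sum>j=k..n. b j * (\<Sum>m=k..j. a j m * S m))"
    using triangular_solve[of k n a n] assms(1) by auto
  have "I x1 x2 = (\<Sum>j=k..n. \<Sum>F | F \<subseteq> {1..n} \<and> card F = j.
           b j * (rkhs_norm (PiE {1..n} X) (kernel_of k n I x0)
                   (kernel_embedding (PiE {1..n} X) (kernel_of k n I x0)
                     (product_measure n F (eta_at F (\<eta> j) x1 x2)
                       (Poly_Mapping.single (restrict x3 ({1..n} - F)) 1))))\<^sup>2)"
    (is "_ = (\<Sum>j=k..n. \<Sum>F | F \<subseteq> {1..n} \<and> card F = j. b j * (?norm j F)\<^sup>2)")
    if x: "x1 \<in> PiE {1..n} X" "x2 \<in> PiE {1..n} X" "x0 \<in> PiE {1..n} X" for x1 x2 x0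
  proof -
    define J where "J = (\<lambda>D. I (splice n D x1 x3) (splice n D x2 x3))"
    define S where "S = (\<lambda>m. \<Sum>D | D \<subseteq> {1..n} \<and> card D = m. J D)"
    \<comment> \<open>Off \<open>D\<close> both points have the coordinates of \<open>x3\<close>, so
      they agree in at least \<open>n - k + 1\<close> places and lie on the extended
      diagonal.\<close>
    have J0: "J D = 0" if D: "D \<subseteq> {1..n}" "card D < k" for D
    proof -
      have "{1..n} - D \<subseteq> {i \<in> {1..n}. splice n D x1 x3 i = splice n D x2 x3 i}"
        by (auto simp: splice_apply)
      then have "card ({1..n} - D) \<le> card {i \<in> {1..n}. splice n D x1 x3 i = splice n D x2 x3 i}"
        by (intro card_mono) auto
      moreover have "card ({1..n} - D) = n - card D"
        using finite_subset[OF D(1)] D(1) by (simp add: card_Diff_subset)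
      ultimately have
        "n + 1 \<le> card {i \<in> {1..n}. splice n D x1 x3 i = splice n D x2 x3 i} + k"
        using D(2) by linarith
      moreover have "splice n D x1 x3 \<in> PiE {1..n} X" "splice n D x2 x3 \<in> PiE {1..n} X"
        using splice_PiE[OF D(1)] x(1,2) assms(9) by blast+
      ultimately have "(splice n D x1 x3, splice n D x2 x3) \<in> extended_diagonal_pred k n X"
        unfolding extended_diagonal_pred_def by blast
      then show ?thesis unfolding J_def by (rule assms(5))
    qed
    have "(\<Sum>F | F \<subseteq> {1..n} \<and> card F = j. (?norm j F)\<^sup>2) = (\<Sum>m=k..j. a j m * S m)"
      if j: "j \<in> {k..n}" for j
    proof -
      have "(?norm j F)\<^sup>2 = (\<Sum>D\<in>Pow F. ((-1) ^ k * autocorrelation j (\<eta> j) {1..card D}) * J D)"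
        if "F \<in> {F. F \<subseteq> {1..n} \<and> card F = j}" for F
      proof -
        have F: "F \<subseteq> {1..n}" "card F = j" using that by auto
        note \<eta> = assms(6)[OF j, folded F(2)]
        have keys: "Poly_Mapping.keys (\<eta> (card F)) \<subseteq> multi_indices (card F)"
          using \<eta> by (simp add: M_space_def)
        show ?thesis
          using rkhs_norm_M_space[OF assms(1,4) x(3) eta_product_M_space[OF F(1) x(1,2) assms(9) \<eta>]]
            double_integral_eta_product[OF assms(3) F(1) x(1,2) assms(9) keys assms(7)[OF j, folded F(2)]]
          by (simp add: F(2) J_def sum_distrib_left mult.assoc)
      qed
      then have "(\<Sum>F | F \<subseteq> {1..n} \<and> card F = j. (?norm j F)\<^sup>2)
          = (\<Sum>F | F \<subseteq> {1..n} \<and> card F = j.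
               \<Sum>D\<in>Pow F. ((-1) ^ k * autocorrelation j (\<eta> j) {1..card D}) * J D)"
        by (intro sum.cong refl)
      also have "\<dots> = (\<Sum>m=k..j. a j m * S m)"
        unfolding a_def S_def using j J0 by (intro sum_over_subsets_of_subsets) auto
      finally show ?thesis .
    qed
    then have "(\<Sum>j=k..n. \<Sum>F | F \<subseteq> {1..n} \<and> card F = j. b j * (?norm j F)\<^sup>2)
        = (\<Sum>j=k..n. b j * (\<Sum>m=k..j. a j m * S m))"
      by (simp flip: sum_distrib_left)
    also have "\<dots> = S n" using b[of S] by simp
    \<comment> \<open>The only set of size \<open>n\<close> is the full one, where \<open>x3\<close>
      is overwritten and the two original points remain.\<close>
    also have "{D. D \<subseteq> {1..n} \<and> card D = n} = {{1..n}}"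
      using card_subset_eq[of "{1..n}"] by auto
    then have "S n = J {1..n}" by (simp add: S_def)
    also have "splice n {1..n} y x3 = y" if "y \<in> PiE {1..n} X" for y
      using PiE_arb[OF that] by (auto simp: splice_apply fun_eq_iff)
    then have "J {1..n} = I x1 x2" using x by (simp add: J_def)
    finally show ?thesis by simp
  qed
  then show ?thesis by blast
qed

end
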